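(* Let $n\ge 1$, let $\lambda\vdash n$ be a partition and let $q$ be a prime power. Let $F_\lambda(q)$ be the number of $n\times n$ upper-triangular nilpotent matrices over $\mathbb{F}_q$ of Jordan type $\lambda$. Then $$F_\lambda(q)=\sum_{T\in \mathrm{SYT}(\lambda)} F_T(q),\qquad F_T(q)=\prod_{i=1}^n T^{(i)}(q),$$ where $\mathrm{SYT}(\lambda)$ is the set of standard Young tableaux of shape $\lambda$ and, for $T\in\mathrm{SYT}(\lambda)$ and $1\le i\le n$, writing $\lambda^{(i)}$ for the shape formed by the boxes of $T$ containing $1,\ldots,i$, $$T^{(i)}(q)=\begin{cases} q^{\,i-\ell(\lambda^{(i)})}, & \text{if the box of } T \text{ containing } i \text{ is in the first column},\\ q^{\,i-(\lambda^{(i)})'_{j}}-q^{\,i-1-(\lambda^{(i)})'_{j-1}}, & \text{if the box of } T \text{ containing } i \text{ is in the } j\text{th column},\ j\ge 2.\end{cases}$$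
   Context: Upper-triangular nilpotent matrices are the strictly upper-triangular ones. A nilpotent $n\times n$ matrix $X$ over $\mathbb{F}_q$ has Jordan type $\lambda=(\lambda_1\ge\cdots\ge\lambda_r>0)\vdash n$ if it is similar under $GL_n(\mathbb{F}_q)$ to $J_{\lambda_1}\oplus\cdots\oplus J_{\lambda_r}$, where $J_i$ is the $i\times i$ Jordan block with eigenvalue $0$. For a partition $\lambda$, $\ell(\lambda)$ is the number of positive parts and $\lambda'_j$ is the number of boxes in the $j$th column of its Ferrers diagram (English notation: $\lambda_i$ left-justified boxes in row $i$, rows listed from top to bottom). A standard Young tableau of shape $\lambda\vdash n$ is a filling of the diagram with $1,\ldots,n$, each used once, increasing along rows (left to right) and columns (top to bottom). *)

theory Defs
  imports
    "Jordan_Normal_Form.Jordan_Normal_Form"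
    "HOL-Library.FuncSet"
begin

definition partition_of :: "nat list \<Rightarrow> nat \<Rightarrow> bool" where
  "partition_of lam n \<longleftrightarrow>
     sorted_wrt (\<ge>) lam \<and> (\<forall>p \<in> set lam. p > 0) \<and> sum_list lam = n"

(* Boxes are pairs (row, column), both numbered from 1, while list positions start at 0. *)
definition diagram :: "nat list \<Rightarrow> (nat \<times> nat) set" where
  "diagram lam = {(r, c). 1 \<le> r \<and> r \<le> length lam \<and> 1 \<le> c \<and> c \<le> lam ! (r - 1)}"

definition num_rows :: "(nat \<times> nat) set \<Rightarrow> nat" where
  "num_rows D = card (fst ` D)"

definition col_length :: "(nat \<times> nat) set \<Rightarrow> nat \<Rightarrow> nat" where
  "col_length D j = card {r. (r, j) \<in> D}"

(* Tableaux are extensional (undefined outside the diagram), so that distinct elements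
   of SYT lam are distinct fillings. *)
definition SYT :: "nat list \<Rightarrow> (nat \<times> nat \<Rightarrow> nat) set" where
  "SYT lam = {T \<in> extensional (diagram lam).
     bij_betw T (diagram lam) {1..sum_list lam} \<and>
     (\<forall>r c c'. (r, c) \<in> diagram lam \<longrightarrow> (r, c') \<in> diagram lam \<longrightarrow> c < c' \<longrightarrow> T (r, c) < T (r, c')) \<and>
     (\<forall>r r' c. (r, c) \<in> diagram lam \<longrightarrow> (r', c) \<in> diagram lam \<longrightarrow> r < r' \<longrightarrow> T (r, c) < T (r', c))}"

definition subshape :: "nat list \<Rightarrow> (nat \<times> nat \<Rightarrow> nat) \<Rightarrow> nat \<Rightarrow> (nat \<times> nat) set" where
  "subshape lam T i = {b \<in> diagram lam. 1 \<le> T b \<and> T b \<le> i}"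

definition entry_col :: "nat list \<Rightarrow> (nat \<times> nat \<Rightarrow> nat) \<Rightarrow> nat \<Rightarrow> nat" where
  "entry_col lam T i = snd (inv_into (diagram lam) T i)"

(* For T in SYT lam and 1 <= i <= sum_list lam the subtractions in the exponents do not
   truncate: if i lies in column j >= 2, then column j - 1 of the subshape consists of
   boxes with entries among 1, ..., i - 1. *)
definition tableau_factor :: "nat list \<Rightarrow> (nat \<times> nat \<Rightarrow> nat) \<Rightarrow> nat \<Rightarrow> int \<Rightarrow> int" where
  "tableau_factor lam T i q =
     (let D = subshape lam T i; j = entry_col lam T i in
      if j = 1 then q ^ (i - num_rows D)
      else q ^ (i - col_length D j) - q ^ (i - 1 - col_length D (j - 1)))"

definition tableau_poly :: "nat list \<Rightarrow> (nat \<times> nat \<Rightarrow> nat) \<Rightarrow> int \<Rightarrow> int" where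
  "tableau_poly lam T q = (\<Prod>i = 1..sum_list lam. tableau_factor lam T i q)"

definition nilpotent_mat :: "'a :: semiring_1 mat \<Rightarrow> bool" where
  "nilpotent_mat A \<longleftrightarrow> (\<exists>k. A ^\<^sub>m k = 0\<^sub>m (dim_row A) (dim_col A))"

definition has_jordan_type :: "'a :: field mat \<Rightarrow> nat list \<Rightarrow> bool" where
  "has_jordan_type A lam \<longleftrightarrow> jordan_nf A (map (\<lambda>k. (k, 0)) lam)"

definition triangular_nilpotents :: "'a :: field itself \<Rightarrow> nat \<Rightarrow> nat list \<Rightarrow> 'a mat set" where
  "triangular_nilpotents _ n lam =
     {A \<in> carrier_mat n n. upper_triangular A \<and> nilpotent_mat A \<and> has_jordan_type A lam}"

end

theory Submission
  imports Defs
    "Jordan_Normal_Form.Jordan_Normal_Form_Existence"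
    "Jordan_Normal_Form.Jordan_Normal_Form_Uniqueness"
    "Berlekamp_Zassenhaus.Berlekamp_Type_Based"
begin

text \<open>
  Write a strictly upper triangular matrix of size $n+1$ as a strictly upper triangular matrix $B$ of
  size $n$ bordered by a last column $v$. The Jordan type of a nilpotent matrix is determined by the
  numbers of vectors killed by its powers. Passing from $B$ to the bordered matrix multiplies the
  number for the $k$th power by $q$ if $B^{k-1}v$ lies in the image of $B^k$, and leaves it unchanged
  otherwise. The vectors $v$ with this property form an increasing sequence of subspaces $W_k$, and if
  $B$ has type $\mu$ then $W_k$ has $q^{n-\mu'_k}$ elements, because $W_k$ is the preimage under
  $B^{k-1}$ of the image of $B^k$. Hence the type of the bordered matrix is $\mu$ with a box added in
  column $j$, where $j$ is the least index with $v \in W_j$, and this type arises from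
  $|W_j| - |W_{j-1}|$ vectors $v$ (from $|W_1|$ vectors if $j = 1$). Removing the largest entry of a
  standard tableau gives the same recursion.
\<close>

subsection \<open>Counting kernels over a finite field\<close>

text \<open>Expansion in a finite basis matches the kernel with the coefficient functions on that
  basis; taking these extensional makes the correspondence one-to-one.\<close>

lemma card_mat_kernel:
  fixes A :: "'a :: {field, finite} mat"
  assumes A: "A \<in> carrier_mat nr nc"
  shows "card (mat_kernel A) = CARD('a) ^ kernel_dim A"
proof -
  interpret kernel nr nc A by unfold_locales (rule A)
  obtain b where b: "finite b" "basis b"
    using kernel_basis_exists[OF A] by auto
  have sub: "b \<subseteq> mat_kernel A"
    using b(2) by (simp add: Ker.basis_def)
  have crit: "\<exists>!a. a \<in> b \<rightarrow>\<^sub>E carrier class_ring \<and> lincomb a b = v" if "v \<in> mat_kernel A" for v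
    using Ker.basis_criterion[OF b(1), THEN iffD1, OF _ b(2)] sub that by simp
  have closed: "lincomb a b \<in> mat_kernel A" for a
    by (rule Ker.lincomb_closed[OF sub]) (auto simp: class_ring_simps)
  have "bij_betw (\<lambda>a. lincomb a b) (b \<rightarrow>\<^sub>E UNIV) (mat_kernel A)"
  proof (rule bij_betwI')
    fix x y assume "x \<in> b \<rightarrow>\<^sub>E (UNIV :: 'a set)" "y \<in> b \<rightarrow>\<^sub>E (UNIV :: 'a set)"
    thus "lincomb x b = lincomb y b \<longleftrightarrow> x = y"
      using crit[OF closed, of x] by (auto simp: class_ring_simps)
  next
    fix v assume "v \<in> mat_kernel A"
    from crit[OF this] show "\<exists>a\<in>b \<rightarrow>\<^sub>E UNIV. v = lincomb a b"
      by (auto simp: class_ring_simps)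
  qed (rule closed)
  hence "card (mat_kernel A) = card (b \<rightarrow>\<^sub>E (UNIV :: 'a set))"
    by (simp add: bij_betw_same_card)
  also have "\<dots> = CARD('a) ^ kernel_dim A"
    using b by (simp add: card_PiE Ker.dim_basis)
  finally show ?thesis .
qed

text \<open>A nonempty fibre is a coset of the kernel: translation by one particular solution is the
  bijection.\<close>

lemma card_solutions:
  fixes A :: "'a :: {field, finite} mat"
  assumes A: "A \<in> carrier_mat nr nc"
  shows "card {w \<in> carrier_vec nc. A *\<^sub>v w = y} =
    (if y \<in> (*\<^sub>v) A ` carrier_vec nc then card (mat_kernel A) else 0)"
proof (cases "y \<in> (*\<^sub>v) A ` carrier_vec nc")
  case True
  then obtain x where x: "x \<in> carrier_vec nc" "y = A *\<^sub>v x" by auto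
  have "bij_betw (\<lambda>w. w + x) (mat_kernel A) {w \<in> carrier_vec nc. A *\<^sub>v w = y}"
  proof (rule bij_betw_byWitness[where f' = "\<lambda>w. w - x"])
    show "(\<lambda>w. w + x) ` mat_kernel A \<subseteq> {w \<in> carrier_vec nc. A *\<^sub>v w = y}"
      using x A by (auto simp: mat_kernel[OF A] mult_add_distrib_mat_vec[OF A])
    show "(\<lambda>w. w - x) ` {w \<in> carrier_vec nc. A *\<^sub>v w = y} \<subseteq> mat_kernel A"
      using x A by (auto simp: mat_kernel[OF A] mult_minus_distrib_mat_vec[OF A])
  qed (use x in \<open>auto simp: mat_kernel[OF A]\<close>)
  thus ?thesis using True by (simp add: bij_betw_same_card)
next
  case False
  hence "{w \<in> carrier_vec nc. A *\<^sub>v w = y} = {}" by auto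
  thus ?thesis using False by simp
qed

text \<open>The preimage is the disjoint union of the fibres over \<open>S\<close>, and each fibre
  is nonempty because \<open>S\<close> lies in the image.\<close>

lemma card_preimage:
  fixes A :: "'a :: {field, finite} mat"
  assumes A: "A \<in> carrier_mat nr nc" and S: "S \<subseteq> (*\<^sub>v) A ` carrier_vec nc"
  shows "card {w \<in> carrier_vec nc. A *\<^sub>v w \<in> S} = card S * card (mat_kernel A)"
proof -
  have "{w \<in> carrier_vec nc. A *\<^sub>v w \<in> S} = (\<Union>y\<in>S. {w \<in> carrier_vec nc. A *\<^sub>v w = y})"
    by auto
  also have "card \<dots> = (\<Sum>y\<in>S. card {w \<in> carrier_vec nc. A *\<^sub>v w = y})"
    using S by (intro card_UN_disjoint) (auto intro: finite_subset)
  also have "\<dots> = (\<Sum>y\<in>S. card (mat_kernel A))"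
    using S by (intro sum.cong refl) (auto simp: card_solutions[OF A])
  finally show ?thesis by simp
qed

lemma rank_nullity_card:
  fixes A :: "'a :: {field, finite} mat"
  assumes A: "A \<in> carrier_mat nr nc"
  shows "card ((*\<^sub>v) A ` carrier_vec nc) * card (mat_kernel A) = CARD('a) ^ nc"
proof -
  have "{w \<in> carrier_vec nc. A *\<^sub>v w \<in> (*\<^sub>v) A ` carrier_vec nc} = carrier_vec nc" by auto
  thus ?thesis using card_preimage[OF A subset_refl] by (simp add: card_carrier_vec)
qed

section \<open>Bordered matrices and the kernels of their powers\<close>

definition border :: "'a :: zero mat \<Rightarrow> 'a vec \<Rightarrow> 'a mat" where
  "border B v = four_block_mat B (mat_of_cols (dim_row B) [v]) (0\<^sub>m 1 (dim_col B)) (0\<^sub>m 1 1)"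

lemma border_carrier:
  "B \<in> carrier_mat n n \<Longrightarrow> border B v \<in> carrier_mat (Suc n) (Suc n)"
  by (auto simp: border_def)

lemma border_index:
  assumes "B \<in> carrier_mat n n" "i < Suc n" "j < Suc n"
  shows "border B v $$ (i, j) = (if i < n then if j < n then B $$ (i, j) else v $ i else 0)"
  using assms by (auto simp: border_def mat_of_cols_index)

text \<open>Multiplying on the right by the bordered matrix, the old last column meets only the zero
  bottom row and drops out, so the new last column is the upper left block applied to
  \<open>v\<close>. The exponent starts at \<open>Suc k\<close> because the zeroth power has a 1 in
  its lower right corner.\<close>

lemma pow_border:
  fixes B :: "'a :: comm_ring_1 mat"
  assumes B: "B \<in> carrier_mat n n"
  shows "border B v ^\<^sub>m Suc k =
    four_block_mat (B ^\<^sub>m Suc k) (B ^\<^sub>m k * mat_of_cols n [v]) (0\<^sub>m 1 n) (0\<^sub>m 1 1)"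
proof (induction k)
  case 0
  have "mat_of_cols n [v] \<in> carrier_mat n 1" by auto
  thus ?case using B by (auto simp: border_def)
next
  case (Suc k)
  have C: "mat_of_cols n [v] \<in> carrier_mat n 1" by auto
  have P: "B ^\<^sub>m k \<in> carrier_mat n n" "B ^\<^sub>m k * B \<in> carrier_mat n n" using B by auto
  have "border B v ^\<^sub>m Suc (Suc k) = border B v ^\<^sub>m Suc k * border B v" by simp
  also have "\<dots> = four_block_mat (B ^\<^sub>m Suc k) (B ^\<^sub>m k * mat_of_cols n [v]) (0\<^sub>m 1 n) (0\<^sub>m 1 1) *
      four_block_mat B (mat_of_cols n [v]) (0\<^sub>m 1 n) (0\<^sub>m 1 1)"
    unfolding Suc.IH using B by (simp add: border_def)
  also have "\<dots> = four_block_mat (B ^\<^sub>m Suc (Suc k)) (B ^\<^sub>m Suc k * mat_of_cols n [v]) (0\<^sub>m 1 n) (0\<^sub>m 1 1)"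
  proof (rule trans[OF mult_four_block_mat[of _ n n _ 1 _ 1 _ _ n _ 1]])
    have "B ^\<^sub>m k * mat_of_cols n [v] * 0\<^sub>m 1 n = 0\<^sub>m n n"
      "B ^\<^sub>m k * mat_of_cols n [v] * 0\<^sub>m 1 1 = 0\<^sub>m n 1"
      using P C by (auto intro: right_mult_zero_mat)
    moreover have "B ^\<^sub>m Suc k * mat_of_cols n [v] \<in> carrier_mat n 1" "B ^\<^sub>m Suc k * B \<in> carrier_mat n n"
      using B C by auto
    moreover have "(0\<^sub>m 1 n * B :: 'a mat) = 0\<^sub>m 1 n" "(0\<^sub>m 1 n * mat_of_cols n [v] :: 'a mat) = 0\<^sub>m 1 1"
      using B C by (auto intro: left_mult_zero_mat)
    ultimately show "four_block_mat (B ^\<^sub>m Suc k * B + B ^\<^sub>m k * mat_of_cols n [v] * 0\<^sub>m 1 n)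
        (B ^\<^sub>m Suc k * mat_of_cols n [v] + B ^\<^sub>m k * mat_of_cols n [v] * 0\<^sub>m 1 1)
        (0\<^sub>m 1 n * B + 0\<^sub>m 1 1 * 0\<^sub>m 1 n) (0\<^sub>m 1 n * mat_of_cols n [v] + 0\<^sub>m 1 1 * 0\<^sub>m 1 1) =
      four_block_mat (B ^\<^sub>m Suc (Suc k)) (B ^\<^sub>m Suc k * mat_of_cols n [v]) (0\<^sub>m 1 n) (0\<^sub>m 1 1)"
      by (simp only: pow_mat.simps) simp
  qed (rule B C zero_carrier_mat pow_carrier_mat[OF B] mult_carrier_mat[OF P(1) C])+
  finally show ?case .
qed

text \<open>A vector \<open>v\<close> lies in \<open>step_space B k\<close> iff bordering \<open>B\<close> by \<open>v\<close> enlarges the kernel of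
  the \<open>k + 1\<close>st power.\<close>

definition step_space :: "'a :: comm_ring_1 mat \<Rightarrow> nat \<Rightarrow> 'a vec set" where
  "step_space B k = {v \<in> carrier_vec (dim_col B).
     B ^\<^sub>m k *\<^sub>v v \<in> (*\<^sub>v) (B ^\<^sub>m Suc k) ` carrier_vec (dim_col B)}"

text \<open>Matrix powers are defined by multiplication on the right, which is the first equation;
  moving the extra factor to the left takes an induction.\<close>

lemma pow_mat_Suc_mult_vec:
  fixes B :: "'a :: comm_ring_1 mat"
  assumes "B \<in> carrier_mat n n" "v \<in> carrier_vec n"
  shows "B ^\<^sub>m Suc k *\<^sub>v v = B ^\<^sub>m k *\<^sub>v (B *\<^sub>v v)"
    "B ^\<^sub>m Suc k *\<^sub>v v = B *\<^sub>v (B ^\<^sub>m k *\<^sub>v v)"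
proof -
  have *: "B ^\<^sub>m Suc k *\<^sub>v v = B ^\<^sub>m k *\<^sub>v (B *\<^sub>v v)" if "v \<in> carrier_vec n" for k v
    using assms(1) that by (auto simp: assoc_mult_mat_vec[of _ n n _ n])
  show "B ^\<^sub>m Suc k *\<^sub>v v = B ^\<^sub>m k *\<^sub>v (B *\<^sub>v v)" by (rule *[OF assms(2)])
  show "B ^\<^sub>m Suc k *\<^sub>v v = B *\<^sub>v (B ^\<^sub>m k *\<^sub>v v)"
    using assms(2)
  proof (induction k arbitrary: v)
    case 0
    then show ?case using assms(1) by auto
  next
    case (Suc k)
    have "B *\<^sub>v v \<in> carrier_vec n" using assms(1) Suc.prems by auto
    thus ?case using Suc.IH[of "B *\<^sub>v v"] *[OF Suc.prems] *[of "B *\<^sub>v v"] *[OF Suc.prems, of "Suc k"]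
      by simp
  qed
qed

text \<open>Applying \<open>B\<close> to a witnessing equation raises both exponents by one and
  keeps the same witness \<open>w\<close>.\<close>

lemma step_space_mono:
  assumes B: "B \<in> carrier_mat n n"
  shows "step_space B k \<subseteq> step_space B (Suc k)"
proof
  fix v assume "v \<in> step_space B k"
  then obtain w where v: "v \<in> carrier_vec n" and w: "w \<in> carrier_vec n"
    and eq: "B ^\<^sub>m k *\<^sub>v v = B ^\<^sub>m Suc k *\<^sub>v w"
    using B by (auto simp: step_space_def)
  have "B ^\<^sub>m Suc k *\<^sub>v v = B ^\<^sub>m Suc (Suc k) *\<^sub>v w"
    unfolding pow_mat_Suc_mult_vec(2)[OF B v] pow_mat_Suc_mult_vec(2)[OF B w, of "Suc k"] eq ..
  thus "v \<in> step_space B (Suc k)"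
    using B v w by (auto simp: step_space_def)
qed

text \<open>\<open>step_space B k\<close> is the space $W_{k+1}$ of the opening text. As a preimage
  under the \<open>k\<close>th power it has size (image of the next power) times (kernel of the
  \<open>k\<close>th power), and rank-nullity removes the image. The product form avoids a
  division.\<close>

lemma card_step_space:
  fixes B :: "'a :: {field, finite} mat"
  assumes B: "B \<in> carrier_mat n n"
  shows "card (step_space B k) * card (mat_kernel (B ^\<^sub>m Suc k)) =
    CARD('a) ^ n * card (mat_kernel (B ^\<^sub>m k))"
proof -
  let ?I = "(*\<^sub>v) (B ^\<^sub>m Suc k) ` carrier_vec n"
  have P: "B ^\<^sub>m k \<in> carrier_mat n n" "B ^\<^sub>m Suc k \<in> carrier_mat n n" using B by auto
  have "?I \<subseteq> (*\<^sub>v) (B ^\<^sub>m k) ` carrier_vec n"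
    using B by (auto simp del: pow_mat.simps simp: pow_mat_Suc_mult_vec(1)[OF B])
  from card_preimage[OF P(1) this]
  have "card (step_space B k) = card ?I * card (mat_kernel (B ^\<^sub>m k))"
    using B by (simp add: step_space_def)
  thus ?thesis using rank_nullity_card[OF P(2)] by (simp add: mult_ac)
qed

text \<open>With last coordinate \<open>t\<close> and remaining coordinates \<open>w\<close>, the
  kernel condition reads \<open>?M *\<^sub>v w = - (t \<cdot>\<^sub>v ?u)\<close>. Each
  \<open>t\<close> for which this is solvable contributes one coset of the kernel of
  \<open>?M\<close>. The value 0 is always solvable; the nonzero values are all solvable or all
  unsolvable, according to whether \<open>?u\<close> lies in the image.\<close>

lemma card_kernel_pow_border:
  fixes B :: "'a :: {field, finite} mat"
  assumes B: "B \<in> carrier_mat n n" and v: "v \<in> carrier_vec n"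
  shows "card (mat_kernel (border B v ^\<^sub>m Suc k)) =
    card (mat_kernel (B ^\<^sub>m Suc k)) * (if v \<in> step_space B k then CARD('a) else 1)"
proof -
  let ?M = "B ^\<^sub>m Suc k" and ?u = "B ^\<^sub>m k *\<^sub>v v" and ?I = "(*\<^sub>v) (B ^\<^sub>m Suc k) ` carrier_vec n"
  have C: "mat_of_cols n [v] \<in> carrier_mat n 1" by auto
  have P: "B ^\<^sub>m k \<in> carrier_mat n n" "?M \<in> carrier_mat n n" using B by auto
  have u: "?u \<in> carrier_vec n" using P v by auto
  \<comment> \<open>The last coordinate comes first in the pair, so that the count becomes a sum
    over \<open>t\<close>.\<close>
  let ?S = "SIGMA t:(UNIV :: 'a set). {w \<in> carrier_vec n. ?M *\<^sub>v w = - (t \<cdot>\<^sub>v ?u)}"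
  have col: "(B ^\<^sub>m k * mat_of_cols n [v]) *\<^sub>v vec 1 (\<lambda>_. t) = t \<cdot>\<^sub>v ?u" for t
  proof -
    have "mat_of_cols n [v] *\<^sub>v vec 1 (\<lambda>_. t) = t \<cdot>\<^sub>v v"
      using v by (intro eq_vecI) (auto simp: mat_of_cols_def scalar_prod_def)
    thus ?thesis
      using P v C by (subst assoc_mult_mat_vec[of _ n n _ 1]) (auto simp: mult_mat_vec)
  qed
  have act: "border B v ^\<^sub>m Suc k *\<^sub>v (w @\<^sub>v vec 1 (\<lambda>_. t)) = (?M *\<^sub>v w + t \<cdot>\<^sub>v ?u) @\<^sub>v 0\<^sub>v 1"
    if "w \<in> carrier_vec n" for w t
  proof -
    have "border B v ^\<^sub>m Suc k *\<^sub>v (w @\<^sub>v vec 1 (\<lambda>_. t)) =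
        (?M *\<^sub>v w + (B ^\<^sub>m k * mat_of_cols n [v]) *\<^sub>v vec 1 (\<lambda>_. t)) @\<^sub>v
        (0\<^sub>m 1 n *\<^sub>v w + 0\<^sub>m 1 1 *\<^sub>v vec 1 (\<lambda>_. t))"
      unfolding pow_border[OF B] using P C that
      by (intro four_block_mat_mult_vec[where ?nr1.0 = n]) (auto simp del: pow_mat.simps)
    moreover have "0\<^sub>m 1 n *\<^sub>v w + 0\<^sub>m 1 1 *\<^sub>v vec 1 (\<lambda>_. t) = 0\<^sub>v 1"
      using that by auto
    ultimately show ?thesis unfolding col by simp
  qed
  have zero: "x + y = 0\<^sub>v n \<longleftrightarrow> x = - y" if "x \<in> carrier_vec n" "y \<in> carrier_vec n" for x y :: "'a vec"
    using that by (auto simp: vec_eq_iff add_eq_0_iff2)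
  have ker: "border B v ^\<^sub>m Suc k \<in> carrier_mat (Suc n) (Suc n)"
    using border_carrier[OF B] by (rule pow_carrier_mat)
  have z: "0\<^sub>v (Suc n) = (0\<^sub>v n @\<^sub>v 0\<^sub>v 1 :: 'a vec)"
    by (rule eq_vecI) (auto simp: less_Suc_eq)
  have mem: "w @\<^sub>v vec 1 (\<lambda>_. t) \<in> mat_kernel (border B v ^\<^sub>m Suc k) \<longleftrightarrow> (t, w) \<in> ?S"
    if "w \<in> carrier_vec n" for w t
  proof -
    have "w @\<^sub>v vec 1 (\<lambda>_. t) \<in> carrier_vec (Suc n)"
      using append_carrier_vec[OF that vec_carrier[of 1 "\<lambda>_. t"]] by simp
    moreover have "?M *\<^sub>v w + t \<cdot>\<^sub>v ?u \<in> carrier_vec n"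
      using that P(2) u by (auto simp del: pow_mat.simps)
    moreover have "?M *\<^sub>v w \<in> carrier_vec n" "t \<cdot>\<^sub>v ?u \<in> carrier_vec n"
      using that P(2) u by (auto simp del: pow_mat.simps)
    ultimately show ?thesis
      unfolding mat_kernel[OF ker] mem_Collect_eq act[OF that] z
      using that zero by (simp add: append_vec_eq[of _ n] del: pow_mat.simps)
  qed
  have "bij_betw (\<lambda>(t, w). w @\<^sub>v vec 1 (\<lambda>_. t)) ?S (mat_kernel (border B v ^\<^sub>m Suc k))"
  proof (rule bij_betw_byWitness[where f' = "\<lambda>x. (x $ n, vec n (\<lambda>i. x $ i))"])
    show "\<forall>p\<in>?S. (\<lambda>x. (x $ n, vec n (\<lambda>i. x $ i))) ((\<lambda>(t, w). w @\<^sub>v vec 1 (\<lambda>_. t)) p) = p"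
      by (auto simp: vec_eq_iff)
    have split: "vec n (\<lambda>i. x $ i) @\<^sub>v vec 1 (\<lambda>_. x $ n) = x" if "x \<in> carrier_vec (Suc n)" for x :: "'a vec"
      using that by (auto simp: vec_eq_iff less_Suc_eq)
    thus "\<forall>x\<in>mat_kernel (border B v ^\<^sub>m Suc k).
        (\<lambda>(t, w). w @\<^sub>v vec 1 (\<lambda>_. t)) (x $ n, vec n (\<lambda>i. x $ i)) = x"
      using mat_kernel_carrier[OF ker] by auto
    show "(\<lambda>(t, w). w @\<^sub>v vec 1 (\<lambda>_. t)) ` ?S \<subseteq> mat_kernel (border B v ^\<^sub>m Suc k)"
      using mem by auto
    show "(\<lambda>x. (x $ n, vec n (\<lambda>i. x $ i))) ` mat_kernel (border B v ^\<^sub>m Suc k) \<subseteq> ?S"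
    proof
      fix p assume "p \<in> (\<lambda>x. (x $ n, vec n (\<lambda>i. x $ i))) ` mat_kernel (border B v ^\<^sub>m Suc k)"
      then obtain x where x: "x \<in> mat_kernel (border B v ^\<^sub>m Suc k)"
        and p: "p = (x $ n, vec n (\<lambda>i. x $ i))" by auto
      have "x \<in> carrier_vec (Suc n)" using x mat_kernel_carrier[OF ker] by auto
      thus "p \<in> ?S" using mem[of "vec n (\<lambda>i. x $ i)" "x $ n"] x split p by auto
    qed
  qed
  hence "card (mat_kernel (border B v ^\<^sub>m Suc k)) = card ?S"
    by (simp add: bij_betw_same_card)
  also have "\<dots> = (\<Sum>t\<in>UNIV. card {w \<in> carrier_vec n. ?M *\<^sub>v w = - (t \<cdot>\<^sub>v ?u)})"
    by (subst card_SigmaI) auto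
  also have "\<dots> = (\<Sum>t\<in>(UNIV :: 'a set). if t = 0 \<or> ?u \<in> ?I then card (mat_kernel ?M) else 0)"
  proof (rule sum.cong[OF refl])
    fix t :: 'a
    \<comment> \<open>Solutions for nonzero \<open>t\<close> and solutions for \<open>?u\<close>
      itself differ by a nonzero scalar.\<close>
    have "- (t \<cdot>\<^sub>v ?u) \<in> ?I \<longleftrightarrow> t = 0 \<or> ?u \<in> ?I"
    proof
      assume "- (t \<cdot>\<^sub>v ?u) \<in> ?I"
      then obtain w where w: "w \<in> carrier_vec n" "- (t \<cdot>\<^sub>v ?u) = ?M *\<^sub>v w" by auto
      show "t = 0 \<or> ?u \<in> ?I"
      proof (cases "t = 0")
        case False
        have "?M *\<^sub>v (- inverse t \<cdot>\<^sub>v w) = (- inverse t) \<cdot>\<^sub>v (?M *\<^sub>v w)"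
          using P(2) w(1) by (simp del: pow_mat.simps add: mult_mat_vec)
        also have "\<dots> = ?u" unfolding w(2)[symmetric] using u False by (auto simp: vec_eq_iff)
        finally show ?thesis using w(1) by (metis image_eqI smult_carrier_vec)
      qed simp
    next
      assume "t = 0 \<or> ?u \<in> ?I"
      then consider "t = 0" | w where "w \<in> carrier_vec n" "?u = ?M *\<^sub>v w" by auto
      thus "- (t \<cdot>\<^sub>v ?u) \<in> ?I"
      proof cases
        case 1
        have "- (t \<cdot>\<^sub>v ?u) = ?M *\<^sub>v 0\<^sub>v n"
          using P u 1 by (auto simp del: pow_mat.simps simp: vec_eq_iff)
        thus ?thesis by auto
      next
        case 2
        have "?M *\<^sub>v ((- t) \<cdot>\<^sub>v w) = (- t) \<cdot>\<^sub>v ?u"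
          using P(2) 2 by (simp del: pow_mat.simps add: mult_mat_vec)
        also have "\<dots> = - (t \<cdot>\<^sub>v ?u)" by (auto simp: vec_eq_iff)
        finally show ?thesis using 2(1) by (metis image_eqI smult_carrier_vec)
      qed
    qed
    thus "card {w \<in> carrier_vec n. ?M *\<^sub>v w = - (t \<cdot>\<^sub>v ?u)} =
        (if t = 0 \<or> ?u \<in> ?I then card (mat_kernel ?M) else 0)"
      unfolding card_solutions[OF P(2)] by simp
  qed
  also have "\<dots> = card (mat_kernel ?M) * (if ?u \<in> ?I then CARD('a) else 1)"
    by simp
  also have "?u \<in> ?I \<longleftrightarrow> v \<in> step_space B k"
    using B v by (simp add: step_space_def)
  finally show ?thesis .
qed

subsection \<open>Young diagrams and standard tableaux\<close>

text \<open>Partition diagrams as sets of boxes instead of lists of parts, so that removing a box is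
  a set difference.\<close>

definition young :: "(nat \<times> nat) set \<Rightarrow> bool" where
  "young D \<longleftrightarrow> finite D \<and> (\<forall>r c. (r, c) \<in> D \<longrightarrow> 1 \<le> r \<and> 1 \<le> c) \<and>
     (\<forall>r c r' c'. (r, c) \<in> D \<longrightarrow> 1 \<le> r' \<longrightarrow> r' \<le> r \<longrightarrow> 1 \<le> c' \<longrightarrow> c' \<le> c \<longrightarrow> (r', c') \<in> D)"

lemma young_finite: "young D \<Longrightarrow> finite D"
  by (simp add: young_def)

lemma young_pos: "young D \<Longrightarrow> (r, c) \<in> D \<Longrightarrow> 1 \<le> r \<and> 1 \<le> c"
  unfolding young_def by blast

lemma young_down:
  "young D \<Longrightarrow> (r, c) \<in> D \<Longrightarrow> 1 \<le> r' \<Longrightarrow> r' \<le> r \<Longrightarrow> 1 \<le> c' \<Longrightarrow> c' \<le> c \<Longrightarrow> (r', c') \<in> D"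
  unfolding young_def by blast

definition corners :: "(nat \<times> nat) set \<Rightarrow> (nat \<times> nat) set" where
  "corners D = {b \<in> D. young (D - {b})}"

text \<open>For the diagram of a Jordan type, the cardinality of \<open>left_part D k\<close> is
  the dimension of the kernel of the \<open>k\<close>th power.\<close>

definition left_part :: "(nat \<times> nat) set \<Rightarrow> nat \<Rightarrow> (nat \<times> nat) set" where
  "left_part D k = {b \<in> D. snd b \<le> k}"

lemma finite_left_part: "young D \<Longrightarrow> finite (left_part D k)"
  by (rule finite_subset[of _ D]) (auto simp: young_finite left_part_def)

lemma down_closed_nat_eq:
  fixes S :: "nat set"
  assumes "finite S" "\<And>r. r \<in> S \<Longrightarrow> 1 \<le> r" "\<And>r r'. r \<in> S \<Longrightarrow> 1 \<le> r' \<Longrightarrow> r' \<le> r \<Longrightarrow> r' \<in> S"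
  shows "S = {1..card S}"
proof (cases "S = {}")
  case False
  have "S = {1..Max S}"
  proof
    show "S \<subseteq> {1..Max S}" using assms(2) Max_ge[OF assms(1)] by auto
    show "{1..Max S} \<subseteq> S" using assms(3)[OF Max_in[OF assms(1) False]] by auto
  qed
  moreover from this have "card S = Max S" by (metis card_atLeastAtMost diff_Suc_1)
  ultimately show ?thesis by simp
qed simp

lemma young_column:
  assumes "young D" "1 \<le> c"
  shows "{r. (r, c) \<in> D} = {1..col_length D c}"
  unfolding col_length_def
proof (rule down_closed_nat_eq)
  have "{r. (r, c) \<in> D} \<subseteq> fst ` D" by force
  thus "finite {r. (r, c) \<in> D}" using young_finite[OF assms(1)] by (simp add: finite_subset)
next
  fix r r' assume "r \<in> {r. (r, c) \<in> D}" "1 \<le> r'" "r' \<le> r"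
  thus "r' \<in> {r. (r, c) \<in> D}" using young_down[OF assms(1), of r c r' c] assms(2) by simp
next
  fix r assume "r \<in> {r. (r, c) \<in> D}"
  thus "1 \<le> r" using young_pos[OF assms(1)] by simp
qed

lemma young_mem_iff:
  assumes "young D"
  shows "(r, c) \<in> D \<longleftrightarrow> 1 \<le> c \<and> 1 \<le> r \<and> r \<le> col_length D c"
proof (cases "1 \<le> c")
  case True
  thus ?thesis using young_column[OF assms True] by auto
next
  case False
  thus ?thesis using young_pos[OF assms, of r c] by auto
qed

lemma young_eqI:
  assumes "young D" "young E" "\<And>c. 1 \<le> c \<Longrightarrow> col_length D c = col_length E c"
  shows "D = E"
proof -
  have "x \<in> D \<longleftrightarrow> x \<in> E" for x
    using assms(3) by (cases x) (auto simp: young_mem_iff[OF assms(1)] young_mem_iff[OF assms(2)])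
  thus ?thesis by blast
qed

text \<open>Every nonempty row starts in column 1. This brings the first-column case of the weight
  into the same form as the others.\<close>

lemma num_rows_young:
  assumes "young D"
  shows "num_rows D = col_length D 1"
proof -
  have "fst ` D = {r. (r, 1) \<in> D}"
  proof
    show "fst ` D \<subseteq> {r. (r, 1) \<in> D}"
    proof
      fix r assume "r \<in> fst ` D"
      then obtain c where "(r, c) \<in> D" by auto
      thus "r \<in> {r. (r, 1) \<in> D}"
        using young_pos[OF assms, of r c] young_down[OF assms, of r c r 1] by simp
    qed
  qed force
  thus ?thesis by (simp add: num_rows_def col_length_def)
qed

lemma left_part_0:
  assumes "young D"
  shows "left_part D 0 = {}"
proof -
  have "snd b \<noteq> 0" if "b \<in> D" for b using young_mem_iff[OF assms] that by (cases b) auto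
  thus ?thesis by (auto simp: left_part_def)
qed

lemma card_left_part_Suc:
  assumes "young D"
  shows "card (left_part D (Suc k)) = card (left_part D k) + col_length D (Suc k)"
proof -
  have fin: "finite {r. (r, Suc k) \<in> D}" using young_column[OF assms, of "Suc k"] by simp
  have "left_part D (Suc k) = left_part D k \<union> (\<lambda>r. (r, Suc k)) ` {r. (r, Suc k) \<in> D}"
    by (auto simp: left_part_def le_Suc_eq)
  also have "card \<dots> = card (left_part D k) + card ((\<lambda>r. (r, Suc k)) ` {r. (r, Suc k) \<in> D})"
    using finite_left_part[OF assms] fin by (intro card_Un_disjoint) (auto simp: left_part_def)
  also have "card ((\<lambda>r. (r, Suc k)) ` {r. (r, Suc k) \<in> D}) = col_length D (Suc k)"
    unfolding col_length_def by (intro card_image inj_onI) auto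
  finally show ?thesis .
qed

text \<open>Successive differences of these counts are the column lengths, and those determine a
  Young diagram.\<close>

lemma young_eq_left_part:
  assumes "young D" "young E" "\<And>k. card (left_part D k) = card (left_part E k)"
  shows "D = E"
proof (rule young_eqI[OF assms(1,2)])
  fix c :: nat assume "1 \<le> c"
  then obtain k where "c = Suc k" by (cases c) auto
  thus "col_length D c = col_length E c"
    using card_left_part_Suc[OF assms(1), of k] card_left_part_Suc[OF assms(2), of k] assms(3)
    by simp
qed

lemma left_part_eventually:
  assumes "young D"
  obtains k where "left_part D k = D"
proof
  have "finite (snd ` D)" using young_finite[OF assms] by simp
  \<comment> \<open>For empty \<open>D\<close> the value of \<open>Max\<close> is unspecified, but
    then both sides are empty for any bound.\<close>
  from Max_ge[OF this] show "left_part D (Max (snd ` D)) = D"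
    by (auto simp: left_part_def)
qed

lemma card_left_part_corner:
  assumes "young D" "b \<in> D"
  shows "card (left_part D k) = card (left_part (D - {b}) k) + (if snd b \<le> k then 1 else 0)"
proof (cases "snd b \<le> k")
  case True
  have "left_part (D - {b}) k = left_part D k - {b}" by (auto simp: left_part_def)
  moreover have "b \<in> left_part D k" using True assms(2) by (simp add: left_part_def)
  ultimately show ?thesis using True finite_left_part[OF assms(1), of k]
    by (metis Suc_eq_plus1 card_Suc_Diff1)
next
  case False
  have "left_part (D - {b}) k = left_part D k" using False by (auto simp: left_part_def)
  thus ?thesis using False by simp
qed

lemma col_length_minus:
  assumes "young D" "(r, c) \<in> D"
  shows "col_length D j = col_length (D - {(r, c)}) j + (if j = c then 1 else 0)"
proof (cases "j = c")
  case True
  have "{r'. (r', c) \<in> D - {(r, c)}} = {r'. (r', c) \<in> D} - {r}" by auto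
  moreover have "finite {r'. (r', c) \<in> D}"
    using young_column[OF assms(1), of c] young_mem_iff[OF assms(1)] assms(2) by simp
  ultimately show ?thesis
    using True assms(2) card_Suc_Diff1[of "{r'. (r', c) \<in> D}" r] by (simp add: col_length_def)
next
  case False
  thus ?thesis by (simp add: col_length_def)
qed

text \<open>This turns a change in kernel dimensions into the removal of a box. The counts force
  \<open>D\<close> and \<open>E\<close> to agree in every column except \<open>Suc j\<close>, where
  \<open>D\<close> is longer by one; since columns are initial segments, the extra box is the bottom
  one.\<close>

lemma remove_box_eq:
  assumes D: "young D" and E: "young E"
    and count: "\<And>k. card (left_part D k) = card (left_part E k) + (if Suc j \<le> k then 1 else 0)"
  obtains b where "b \<in> corners D" "snd b = Suc j" "D - {b} = E"
proof -
  \<comment> \<open>In the difference of consecutive counts the indicator survives only in passing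
    from \<open>j\<close> to \<open>Suc j\<close>.\<close>
  have col: "col_length D (Suc k) = col_length E (Suc k) + (if k = j then 1 else 0)" for k
  proof -
    have "col_length D (Suc k) = card (left_part D (Suc k)) - card (left_part D k)"
      by (simp add: card_left_part_Suc[OF D])
    also have "\<dots> = card (left_part E k) + col_length E (Suc k) + (if j \<le> k then 1 else 0) -
        (card (left_part E k) + (if j < k then 1 else 0))"
      unfolding count card_left_part_Suc[OF E] by (simp add: Suc_le_eq)
    finally show ?thesis by (cases j k rule: linorder_cases) simp_all
  qed
  let ?b = "(col_length D (Suc j), Suc j)"
  have b: "?b \<in> D" using young_mem_iff[OF D] col[of j] by simp
  have "x \<in> D - {?b} \<longleftrightarrow> x \<in> E" for x
  proof (cases x)
    case (Pair r c)
    show ?thesis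
    proof (cases c)
      case 0
      thus ?thesis using Pair young_mem_iff[OF D] young_mem_iff[OF E] by simp
    next
      case (Suc k)
      thus ?thesis using Pair young_mem_iff[OF D, of r c] young_mem_iff[OF E, of r c] col[of k]
        by (auto split: if_splits)
    qed
  qed
  hence eq: "D - {?b} = E" by blast
  show ?thesis
  proof (rule that)
    show "?b \<in> corners D" unfolding corners_def using b eq E by simp
    show "D - {?b} = E" by (rule eq)
  qed simp
qed

section \<open>Standard fillings and removal of the largest entry\<close>

text \<open>The conditions of \<open>SYT\<close> for an arbitrary set of boxes, the form in which
  the recursion over corners runs.\<close>

definition tableaux :: "(nat \<times> nat) set \<Rightarrow> (nat \<times> nat \<Rightarrow> nat) set" where
  "tableaux D = {T \<in> extensional D. bij_betw T D {1..card D} \<and>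
     (\<forall>r c c'. (r, c) \<in> D \<longrightarrow> (r, c') \<in> D \<longrightarrow> c < c' \<longrightarrow> T (r, c) < T (r, c')) \<and>
     (\<forall>r r' c. (r, c) \<in> D \<longrightarrow> (r', c) \<in> D \<longrightarrow> r < r' \<longrightarrow> T (r, c) < T (r', c))}"

text \<open>The factor $T^{(i)}(q)$ depends only on the shape of the boxes with entries at most \<open>i\<close>
  and on the column of the box containing \<open>i\<close>.\<close>

definition box_weight :: "(nat \<times> nat) set \<Rightarrow> nat \<Rightarrow> int \<Rightarrow> int" where
  "box_weight D j q =
     (if j = 1 then q ^ (card D - num_rows D)
      else q ^ (card D - col_length D j) - q ^ (card D - 1 - col_length D (j - 1)))"

definition filling_weight :: "(nat \<times> nat) set \<Rightarrow> (nat \<times> nat \<Rightarrow> nat) \<Rightarrow> int \<Rightarrow> int" where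
  "filling_weight D T q =
     (\<Prod>i = 1..card D. box_weight {b \<in> D. 1 \<le> T b \<and> T b \<le> i} (snd (inv_into D T i)) q)"

text \<open>Compare through the intermediate box \<open>(r', c)\<close>, which belongs to
  \<open>D\<close> by down-closure.\<close>

lemma tableaux_mono:
  assumes D: "young D" and T: "T \<in> tableaux D" and "(r, c) \<in> D" "1 \<le> r'" "r' \<le> r" "1 \<le> c'" "c' \<le> c"
  shows "T (r', c') \<le> T (r, c)"
proof -
  have "1 \<le> c" using assms(6,7) by simp
  hence mem: "(r', c) \<in> D" "(r', c') \<in> D"
    using young_down[OF D assms(3), of r' c] young_down[OF D assms(3), of r' c'] assms(4-) by simp_all
  have "T (r', c') \<le> T (r', c)" using T mem assms(7) unfolding tableaux_def
    by (cases "c' = c") (auto intro: less_imp_le)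
  also have "\<dots> \<le> T (r, c)" using T mem assms(3,5) unfolding tableaux_def
    by (cases "r' = r") (auto intro: less_imp_le)
  finally show ?thesis .
qed

text \<open>If a remaining box lay weakly below and to the right of \<open>b\<close>, its entry
  would be at least the maximum \<open>T b\<close>, forcing it to be \<open>b\<close>. Hence
  down-closure survives the removal.\<close>

lemma max_box_corner:
  assumes D: "young D" and T: "T \<in> tableaux D" and b: "b \<in> D" "T b = card D"
  shows "b \<in> corners D"
proof -
  have bij: "bij_betw T D {1..card D}" using T by (simp add: tableaux_def)
  have max: "x = b" if "x \<in> D" "T b \<le> T x" for x
  proof -
    have "T x \<le> card D" using bij that(1) by (auto simp: bij_betw_def)
    hence "T x = T b" using that(2) b(2) by simp
    thus ?thesis using bij that(1) b(1) by (auto simp: bij_betw_def inj_on_def)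
  qed
  have "young (D - {b})" unfolding young_def
  proof (intro conjI allI impI)
    fix r c r' c' assume *: "(r, c) \<in> D - {b}" "1 \<le> r'" "r' \<le> r" "1 \<le> c'" "c' \<le> c"
    have "(r', c') \<in> D" using young_down[OF D _ *(2-)] *(1) by simp
    moreover have "(r', c') \<noteq> b" using tableaux_mono[OF D T _ *(2-)] *(1) max[of "(r, c)"] by auto
    ultimately show "(r', c') \<in> D - {b}" by simp
  next
    show "finite (D - {b})" using young_finite[OF D] by simp
  qed (auto dest: young_pos[OF D])
  thus ?thesis using b(1) by (simp add: corners_def)
qed

lemma restrict_tableau:
  assumes D: "young D" and T: "T \<in> tableaux D" and b: "b \<in> D" "T b = card D"
  shows "restrict T (D - {b}) \<in> tableaux (D - {b})"
proof -
  have fin: "finite D" by (rule young_finite[OF D])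
  have bij: "bij_betw T D {1..card D}" using T by (simp add: tableaux_def)
  have "T ` (D - {b}) = {1..card D} - {card D}"
    using bij b by (auto simp: bij_betw_def inj_on_def)
  also have "\<dots> = {1..card (D - {b})}" using b(1) fin card_Suc_Diff1[OF fin b(1)] by auto
  finally have "bij_betw (restrict T (D - {b})) (D - {b}) {1..card (D - {b})}"
    using bij by (auto simp: bij_betw_def inj_on_def)
  thus ?thesis using T unfolding tableaux_def by auto
qed

text \<open>The new entry exceeds all others, and a corner has no box after it in its row or column,
  so it can only be the larger side of an inequality.\<close>

lemma extend_tableau:
  assumes D: "young D" and b: "b \<in> corners D" and T: "T \<in> tableaux (D - {b})"
  shows "T(b := card D) \<in> tableaux D"
proof -
  have fin: "finite D" by (rule young_finite[OF D])
  have bD: "b \<in> D" and y: "young (D - {b})" using b by (auto simp: corners_def)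
  have card: "card D = Suc (card (D - {b}))" using card_Suc_Diff1[OF fin bD] by simp
  have bij: "bij_betw T (D - {b}) {1..card (D - {b})}" using T by (simp add: tableaux_def)
  have lt: "T x < card D" if "x \<in> D" "x \<noteq> b" for x
  proof -
    have "T x \<in> {1..card (D - {b})}" using bij_betwE[OF bij] that by blast
    thus ?thesis unfolding card by (simp del: card_Diff_insert)
  qed
  have bij': "bij_betw (T(b := card D)) D {1..card D}"
    unfolding bij_betw_def
  proof
    show "inj_on (T(b := card D)) D"
    proof (rule inj_onI)
      fix x y assume *: "x \<in> D" "y \<in> D" "(T(b := card D)) x = (T(b := card D)) y"
      have "inj_on T (D - {b})" using bij by (simp add: bij_betw_def)
      thus "x = y" using * lt[of x] lt[of y] by (auto simp: inj_on_def split: if_splits)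
    qed
    have "(T(b := card D)) ` D = insert (card D) (T ` (D - {b}))" using bD by auto
    also have "T ` (D - {b}) = {1..card (D - {b})}" using bij by (simp add: bij_betw_def)
    also have "insert (card D) {1..card (D - {b})} = {1..card D}" unfolding card by auto
    finally show "(T(b := card D)) ` D = {1..card D}" .
  qed
  \<comment> \<open>A box weakly above and to the left of a remaining box is itself in the Young
    diagram \<open>D - {b}\<close>, hence is not \<open>b\<close>.\<close>
  have out: "(r', c') \<noteq> b" if "(r, c) \<in> D" "(r, c) \<noteq> b" "1 \<le> r'" "r' \<le> r" "1 \<le> c'" "c' \<le> c" for r c r' c'
    using young_down[OF y, of r c r' c'] that by blast
  have pos: "1 \<le> r \<and> 1 \<le> c" if "(r, c) \<in> D" for r c by (rule young_pos[OF D that])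
  have "(T(b := card D)) (r, c) < (T(b := card D)) (r, c')"
    if *: "(r, c) \<in> D" "(r, c') \<in> D" "c < c'" for r c c'
  proof (cases "(r, c') = b")
    case True
    thus ?thesis using * lt by auto
  next
    case False
    hence "(r, c) \<noteq> b" using out[OF *(2)] * pos by (auto simp: less_imp_le)
    thus ?thesis using False * T by (auto simp: tableaux_def)
  qed
  moreover have "(T(b := card D)) (r, c) < (T(b := card D)) (r', c)"
    if *: "(r, c) \<in> D" "(r', c) \<in> D" "r < r'" for r r' c
  proof (cases "(r', c) = b")
    case True
    thus ?thesis using * lt by auto
  next
    case False
    hence "(r, c) \<noteq> b" using out[OF *(2)] * pos by (auto simp: less_imp_le)
    thus ?thesis using False * T by (auto simp: tableaux_def)
  qed
  moreover have "T(b := card D) \<in> extensional D" using T bD by (auto simp: tableaux_def extensional_def)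
  ultimately show ?thesis using bij' by (simp add: tableaux_def)
qed

text \<open>For every entry up to \<open>m\<close> the subshape and the position of the entry are
  unaffected by the new box. The one additional factor has the full diagram as subshape and
  \<open>b\<close> as box.\<close>

lemma filling_weight_extend:
  assumes D: "young D" and b: "b \<in> corners D" and T: "T \<in> tableaux (D - {b})"
  shows "filling_weight D (T(b := card D)) q = filling_weight (D - {b}) T q * box_weight D (snd b) q"
proof -
  have fin: "finite D" by (rule young_finite[OF D])
  have bD: "b \<in> D" using b by (auto simp: corners_def)
  define m where "m = card (D - {b})"
  have card: "card D = Suc m" using card_Suc_Diff1[OF fin bD] by (simp add: m_def)
  define U where "U = T(b := card D)"
  have U: "U \<in> tableaux D" unfolding U_def by (rule extend_tableau[OF assms])
  have bijU: "bij_betw U D {1..card D}" using U by (simp add: tableaux_def)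
  have bijT: "bij_betw T (D - {b}) {1..m}" using T by (simp add: tableaux_def m_def)
  have "{x \<in> D. 1 \<le> U x \<and> U x \<le> i} = {x \<in> D - {b}. 1 \<le> T x \<and> T x \<le> i}"
    if "i \<in> {1..m}" for i
    using that card by (auto simp: U_def)
  moreover have "inv_into D U i = inv_into (D - {b}) T i" if i: "i \<in> {1..m}" for i
  proof (rule inv_into_f_eq)
    show "inj_on U D" using bijU by (simp add: bij_betw_def)
    have "i \<in> T ` (D - {b})" using bijT i by (simp add: bij_betw_def)
    hence "inv_into (D - {b}) T i \<in> D - {b}" "T (inv_into (D - {b}) T i) = i"
      by (rule inv_into_into, rule f_inv_into_f)
    thus "inv_into (D - {b}) T i \<in> D" "U (inv_into (D - {b}) T i) = i" by (auto simp: U_def)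
  qed
  ultimately have prefix: "(\<Prod>i = 1..m. box_weight {x \<in> D. 1 \<le> U x \<and> U x \<le> i} (snd (inv_into D U i)) q) =
      filling_weight (D - {b}) T q"
    unfolding filling_weight_def m_def[symmetric] by (intro prod.cong refl) (simp only:)
  have "{x \<in> D. 1 \<le> U x \<and> U x \<le> Suc m} = D"
    using bijU card by (auto simp: bij_betw_def)
  moreover have "inv_into D U (Suc m) = b"
    using bijU bD card by (intro inv_into_f_eq) (auto simp: bij_betw_def U_def)
  ultimately show ?thesis
    unfolding filling_weight_def[of D] U_def[symmetric] unfolding card using prefix by simp
qed

text \<open>Deleting the largest entry is a bijection onto pairs of a corner and a tableau on the
  remaining boxes; its inverse writes \<open>card D\<close> into the corner.\<close>

lemma sum_tableaux_corners:
  assumes D: "young D" "D \<noteq> {}"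
  shows "(\<Sum>T\<in>tableaux D. filling_weight D T q) =
    (\<Sum>b\<in>corners D. (\<Sum>T\<in>tableaux (D - {b}). filling_weight (D - {b}) T q) * box_weight D (snd b) q)"
proof -
  have fin: "finite D" by (rule young_finite[OF D(1)])
  hence fin_c: "finite (corners D)" by (simp add: corners_def)
  have fin_t: "finite (tableaux E)" if "E \<subseteq> D" for E
  proof (rule finite_subset)
    show "tableaux E \<subseteq> E \<rightarrow>\<^sub>E {1..card E}" by (auto simp: tableaux_def bij_betw_def PiE_def)
    show "finite (E \<rightarrow>\<^sub>E {1..card E})" using fin that by (intro finite_PiE) (auto intro: finite_subset)
  qed
  have "(\<Sum>b\<in>corners D. (\<Sum>T\<in>tableaux (D - {b}). filling_weight (D - {b}) T q) * box_weight D (snd b) q) =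
      (\<Sum>(b, T)\<in>(SIGMA b:corners D. tableaux (D - {b})). filling_weight (D - {b}) T q * box_weight D (snd b) q)"
    using fin_c fin_t by (subst sum.Sigma[symmetric]) (auto simp: sum_distrib_right)
  also have "\<dots> = (\<Sum>T\<in>tableaux D. filling_weight D T q)"
  proof (rule sum.reindex_bij_witness[where
        i = "\<lambda>T. (inv_into D T (card D), restrict T (D - {inv_into D T (card D)}))" and
        j = "\<lambda>(b, T). T(b := card D)"])
    fix p assume "p \<in> (SIGMA b:corners D. tableaux (D - {b}))"
    then obtain b T where p: "p = (b, T)" "b \<in> corners D" "T \<in> tableaux (D - {b})" by auto
    have U: "T(b := card D) \<in> tableaux D" by (rule extend_tableau[OF D(1) p(2,3)])
    have inv: "inv_into D (T(b := card D)) (card D) = b"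
      using U p(2) by (intro inv_into_f_eq) (auto simp: tableaux_def bij_betw_def corners_def)
    have "T \<in> extensional (D - {b})" using p(3) by (simp add: tableaux_def)
    hence "restrict (T(b := card D)) (D - {b}) = T"
      by (auto simp: extensional_def fun_eq_iff restrict_def)
    thus "(inv_into D ((\<lambda>(b, T). T(b := card D)) p) (card D),
        restrict ((\<lambda>(b, T). T(b := card D)) p) (D - {inv_into D ((\<lambda>(b, T). T(b := card D)) p) (card D)})) = p"
      by (simp add: p(1) inv)
    show "(\<lambda>(b, T). T(b := card D)) p \<in> tableaux D" using U p(1) by simp
    show "filling_weight D ((\<lambda>(b, T). T(b := card D)) p) q =
        (case p of (b, T) \<Rightarrow> filling_weight (D - {b}) T q * box_weight D (snd b) q)"
      using filling_weight_extend[OF D(1) p(2,3)] p(1) by simp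
  next
    fix T assume T: "T \<in> tableaux D"
    let ?b = "inv_into D T (card D)"
    \<comment> \<open>Since \<open>D\<close> is nonempty, \<open>card D\<close> is an actual entry,
      so \<open>inv_into\<close> returns its box and not a default value.\<close>
    have "card D \<in> {1..card D}" using D(2) fin by (simp add: Suc_le_eq card_gt_0_iff)
    hence "card D \<in> T ` D" using T by (simp add: tableaux_def bij_betw_def)
    hence b: "?b \<in> D" "T ?b = card D" by (rule inv_into_into, rule f_inv_into_f)
    show "(?b, restrict T (D - {?b})) \<in> (SIGMA b:corners D. tableaux (D - {b}))"
      using max_box_corner[OF D(1) T b] restrict_tableau[OF D(1) T b] by simp
    show "(\<lambda>(b, T). T(b := card D)) (?b, restrict T (D - {?b})) = T"
      using b T by (auto simp: fun_eq_iff tableaux_def extensional_def)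
  qed
  finally show ?thesis by simp
qed

subsection \<open>Jordan types and kernels of powers\<close>

text \<open>Conjugation by the permutation matrix that exchanges the two groups of
  coordinates.\<close>

lemma similar_mat_four_block_swap:
  fixes A D :: "'a :: comm_ring_1 mat"
  assumes A: "A \<in> carrier_mat n n" and D: "D \<in> carrier_mat m m"
  shows "similar_mat (four_block_mat A (0\<^sub>m n m) (0\<^sub>m m n) D) (four_block_mat D (0\<^sub>m m n) (0\<^sub>m n m) A)"
proof -
  let ?P = "four_block_mat (0\<^sub>m n m) (1\<^sub>m n) (1\<^sub>m m) (0\<^sub>m m n) :: 'a mat"
  let ?Q = "four_block_mat (0\<^sub>m m n) (1\<^sub>m m) (1\<^sub>m n) (0\<^sub>m n m) :: 'a mat"
  let ?X = "four_block_mat A (0\<^sub>m n m) (0\<^sub>m m n) D"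
  let ?Y = "four_block_mat D (0\<^sub>m m n) (0\<^sub>m n m) A"
  have PQ: "?P * ?Q = 1\<^sub>m (n + m)"
    by (rule trans[OF mult_four_block_mat[of _ n m _ n _ m _ _ n _ m]],
      (rule zero_carrier_mat one_carrier_mat)+) simp
  have QP: "?Q * ?P = 1\<^sub>m (n + m)"
    by (rule trans[OF mult_four_block_mat[of _ m n _ m _ n _ _ m _ n]],
      (rule zero_carrier_mat one_carrier_mat)+) (simp add: add.commute)
  have PY: "?P * ?Y = four_block_mat (0\<^sub>m n m) A D (0\<^sub>m m n)"
    by (rule trans[OF mult_four_block_mat[of _ n m _ n _ m _ _ m _ n]],
      (rule zero_carrier_mat one_carrier_mat A D)+) (use A D in simp)
  have "four_block_mat (0\<^sub>m n m) A D (0\<^sub>m m n) * ?Q = ?X"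
    by (rule trans[OF mult_four_block_mat[of _ n m _ n _ m _ _ n _ m]],
      (rule zero_carrier_mat one_carrier_mat A D)+) (use A D in simp)
  hence X: "?X = ?P * ?Y * ?Q" unfolding PY by simp
  have "?P \<in> carrier_mat (n + m) (m + n)" "?Q \<in> carrier_mat (m + n) (n + m)"
    "?X \<in> carrier_mat (n + m) (n + m)" "?Y \<in> carrier_mat (m + n) (m + n)"
    using A D by (auto intro!: four_block_carrier_mat)
  thus ?thesis
    by (intro similar_matI[OF _ PQ QP X]) (simp_all add: add.commute)
qed

lemma jordan_matrix_Cons:
  "jordan_matrix (x # xs) = four_block_mat (jordan_block (fst x) (snd x))
     (0\<^sub>m (fst x) (sum_list (map fst xs))) (0\<^sub>m (sum_list (map fst xs)) (fst x)) (jordan_matrix xs)"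
  using jordan_matrix_dim[of xs]
  by (cases x) (simp add: jordan_matrix_def Let_def)

lemma jordan_matrix_append:
  "jordan_matrix (xs @ ys) = four_block_mat (jordan_matrix xs)
     (0\<^sub>m (sum_list (map fst xs)) (sum_list (map fst ys)))
     (0\<^sub>m (sum_list (map fst ys)) (sum_list (map fst xs))) (jordan_matrix ys)"
  using jordan_matrix_dim[of xs] jordan_matrix_dim[of ys]
  by (simp add: jordan_matrix_def diag_block_mat_append Let_def)

text \<open>Jordan types list block sizes in decreasing order, whereas a computed normal form may
  have any order. The first block \<open>x\<close> is located in \<open>ys\<close>; a block swap
  moves the blocks preceding it to the end, and induction handles the rest.\<close>

lemma similar_jordan_matrix_mset:
  fixes xs ys :: "(nat \<times> 'a :: comm_ring_1) list"
  assumes "mset xs = mset ys"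
  shows "similar_mat (jordan_matrix xs) (jordan_matrix ys)"
  using assms
proof (induction xs arbitrary: ys)
  case Nil
  hence "ys = []" by simp
  thus ?case by (auto intro: similar_mat_refl jordan_matrix_carrier)
next
  case (Cons x xs)
  hence "x \<in> set ys" by (metis list.set_intros(1) mset_eq_setD)
  then obtain us vs where ys: "ys = us @ x # vs" by (meson split_list)
  have eq: "mset xs = mset (vs @ us)" using Cons.prems by (simp add: ys)
  hence len: "sum_list (map fst (vs @ us)) = sum_list (map fst xs)"
    by (metis mset_map sum_mset_sum_list)
  have "similar_mat (jordan_matrix (x # xs)) (jordan_matrix (x # vs @ us))"
    unfolding jordan_matrix_Cons len
    by (rule similar_mat_four_block_0_0[OF similar_mat_refl Cons.IH[OF eq]])
      (rule jordan_block_carrier jordan_matrix_carrier)+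
  moreover have "similar_mat (jordan_matrix ((x # vs) @ us)) (jordan_matrix (us @ (x # vs)))"
    unfolding jordan_matrix_append
    by (rule similar_mat_four_block_swap) (rule jordan_matrix_carrier)+
  ultimately show ?case unfolding ys by (auto intro: similar_mat_trans)
qed

section \<open>Kernel sizes as a substitute for the Jordan type\<close>

definition strict_upper_mats :: "nat \<Rightarrow> 'a :: zero mat set" where
  "strict_upper_mats n = {A \<in> carrier_mat n n. \<forall>i<n. \<forall>j\<le>i. A $$ (i, j) = 0}"

text \<open>Encodes the Jordan type of a nilpotent matrix by the sizes of the kernels of its powers:
  these are computable under bordering, while a normal form is not directly.\<close>

definition kernel_type :: "'a :: {field, finite} mat \<Rightarrow> (nat \<times> nat) set \<Rightarrow> bool" where
  "kernel_type A D \<longleftrightarrow> (\<forall>k. card (mat_kernel (A ^\<^sub>m k)) = CARD('a) ^ card (left_part D k))"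

lemma card_field_gt_1: "1 < CARD('a :: {field, finite})"
proof -
  have "card {0, 1 :: 'a} \<le> CARD('a)" by (rule card_mono) auto
  thus ?thesis by simp
qed

lemma kernel_type_unique:
  assumes "young D" "young E" "kernel_type A D" "kernel_type A E"
  shows "D = E"
proof (rule young_eq_left_part[OF assms(1,2)])
  fix k
  show "card (left_part D k) = card (left_part E k)"
    using assms(3,4) power_inject_exp[OF card_field_gt_1] unfolding kernel_type_def by metis
qed

text \<open>The kernel of the \<open>k\<close>th power is the generalised eigenspace for 0 of order
  \<open>k\<close>, to whose dimension a block of size \<open>p\<close> contributes
  \<open>min k p\<close>.\<close>

lemma card_kernel_pow_jordan_nf:
  fixes A :: "'a :: {field, finite} mat"
  assumes A: "A \<in> carrier_mat n n" and nf: "jordan_nf A (map (\<lambda>k. (k, 0)) lam)"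
  shows "card (mat_kernel (A ^\<^sub>m k)) = CARD('a) ^ (\<Sum>p\<leftarrow>lam. min k p)"
proof -
  have "char_matrix A 0 = A" using A by (auto simp: char_matrix_def)
  hence "kernel_dim (A ^\<^sub>m k) = dim_gen_eigenspace A 0 k" by (simp add: dim_gen_eigenspace_def)
  also have "\<dots> = (\<Sum>p\<leftarrow>lam. min k p)"
    unfolding dim_gen_eigenspace[OF nf] by (simp add: filter_map o_def)
  finally show ?thesis using card_mat_kernel[of "A ^\<^sub>m k" n n] A by simp
qed

lemma left_part_diagram:
  "left_part (diagram lam) k = (SIGMA r:{1..length lam}. {1..min k (lam ! (r - 1))})"
  by (auto simp: left_part_def diagram_def)

lemma diagram_eq_Sigma: "diagram lam = (SIGMA r:{1..length lam}. {1..lam ! (r - 1)})"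
  by (auto simp: diagram_def)

lemma sum_list_rows: "(\<Sum>r = 1..length lam. f (lam ! (r - 1))) = (\<Sum>p\<leftarrow>lam. f p)"
proof -
  have "(\<Sum>r = 1..length lam. f (lam ! (r - 1))) = (\<Sum>i = 0..<length lam. f (lam ! i))"
    by (rule sum.reindex_bij_witness[where i = Suc and j = "\<lambda>r. r - 1"]) auto
  thus ?thesis by (simp add: sum_list_sum_nth)
qed

lemma card_left_part_diagram: "card (left_part (diagram lam) k) = (\<Sum>p\<leftarrow>lam. min k p)"
  unfolding left_part_diagram sum_list_rows[symmetric] by simp

lemma card_diagram: "card (diagram lam) = sum_list lam"
  unfolding diagram_eq_Sigma using sum_list_rows[of "\<lambda>p. p" lam] by simp

lemma young_diagram:
  assumes "partition_of lam n"
  shows "young (diagram lam)"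
  unfolding young_def
proof (intro conjI allI impI)
  show "finite (diagram lam)" unfolding diagram_eq_Sigma by simp
next
  fix r c r' c' assume *: "(r, c) \<in> diagram lam" "1 \<le> r'" "r' \<le> r" "1 \<le> c'" "c' \<le> c"
  have "lam ! (r' - 1) \<ge> lam ! (r - 1)"
  proof (cases "r' = r")
    case False
    thus ?thesis using * assms
      by (auto simp: partition_of_def diagram_def sorted_wrt_iff_nth_less)
  qed simp
  thus "(r', c') \<in> diagram lam" using * by (auto simp: diagram_def)
qed (auto simp: diagram_def)

text \<open>The first column gives the number of parts, because positivity excludes trailing zeros;
  the rows then give the parts.\<close>

lemma diagram_inj:
  assumes "partition_of lam n" "partition_of mu m" "diagram lam = diagram mu"
  shows "lam = mu"
proof (rule nth_equalityI)
  have len: "{r. (r, 1) \<in> diagram nu} = {1..length nu}" if "partition_of nu k" for nu k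
  proof -
    have "1 \<le> nu ! (r - 1)" if "1 \<le> r" "r \<le> length nu" for r
      using \<open>partition_of nu k\<close> that by (auto simp: partition_of_def Suc_le_eq)
    thus ?thesis by (auto simp: diagram_def)
  qed
  have "{1..length lam} = {1..length mu}" using len[OF assms(1)] len[OF assms(2)] assms(3) by simp
  thus eq: "length lam = length mu" by (metis card_atLeastAtMost diff_Suc_1)
  fix i assume i: "i < length lam"
  have row: "{c. (Suc i, c) \<in> diagram nu} = {1..nu ! i}" if "i < length nu" for nu
    using that by (auto simp: diagram_def)
  have "{1..lam ! i} = {c. (Suc i, c) \<in> diagram lam}" by (rule row[OF i, symmetric])
  also have "\<dots> = {1..mu ! i}" unfolding assms(3) using i eq by (intro row) simp
  finally have "{1..lam ! i} = {1..mu ! i}" .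
  thus "lam ! i = mu ! i" by (metis card_atLeastAtMost diff_Suc_1)
qed

text \<open>Row by row, the first \<open>k\<close> columns contain \<open>min k p\<close> boxes for
  each part \<open>p\<close>, which is what a Jordan block of size \<open>p\<close> contributes to
  the kernel.\<close>

lemma kernel_type_diagram:
  assumes "A \<in> carrier_mat n n" "has_jordan_type A lam"
  shows "kernel_type A (diagram lam)"
  unfolding kernel_type_def
  using assms by (simp add: card_kernel_pow_jordan_nf card_left_part_diagram has_jordan_type_def)

text \<open>Diagonal entries of a triangular matrix are roots of the characteristic polynomial,
  which here is a product of powers of the indeterminate.\<close>

lemma diag_eq_0_if_jordan_type:
  assumes A: "A \<in> carrier_mat n n" and ut: "upper_triangular A" and ty: "has_jordan_type A lam"
    and i: "i < n"
  shows "A $$ (i, i) = 0"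
proof -
  let ?a = "A $$ (i, i)"
  have "?a \<in> set (diag_mat A)" using A i by (auto simp: diag_mat_def)
  hence "poly (char_poly A) ?a = 0"
    by (auto simp: char_poly_upper_triangular[OF A ut] poly_prod_list prod_list_zero_iff image_iff)
  moreover have "char_poly A = (\<Prod>k\<leftarrow>lam. [:0, 1:] ^ k)"
    using jordan_nf_char_poly[OF ty[unfolded has_jordan_type_def]] by (simp add: o_def)
  ultimately show ?thesis by (auto simp: poly_prod_list prod_list_zero_iff)
qed

text \<open>A triangular matrix has a Jordan normal form over any field. The characteristic
  polynomial is the \<open>n\<close>th power of the indeterminate, so all its eigenvalues are 0, and
  reordering the blocks yields a partition.\<close>

lemma jordan_type_exists:
  fixes A :: "'a :: field mat"
  assumes "A \<in> strict_upper_mats n"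
  obtains lam where "partition_of lam n" "has_jordan_type A lam"
proof -
  have A: "A \<in> carrier_mat n n" using assms by (simp add: strict_upper_mats_def)
  have ut: "upper_triangular A" using assms by (auto simp: strict_upper_mats_def)
  define nas where "nas = triangular_to_jnf_vector A"
  have nf: "jordan_nf A nas" unfolding nas_def by (rule triangular_to_jnf_vector[OF A ut])
  have "diag_mat A = replicate n 0"
    using assms by (intro nth_equalityI) (auto simp: diag_mat_def strict_upper_mats_def)
  hence cp: "char_poly A = [:0, 1:] ^ n"
    by (simp add: char_poly_upper_triangular[OF A ut] prod_list_replicate)
  have pos: "0 < fst x" if "x \<in> set nas" for x using nf that by (force simp: jordan_nf_def)
  \<comment> \<open>A block of positive size makes its eigenvalue a root of the characteristic
    polynomial, which has no root other than 0.\<close>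
  have zero: "snd x = 0" if x: "x \<in> set nas" for x
  proof -
    have "poly ([:- snd x, 1:] ^ fst x) (snd x) = 0" using pos[OF x] by simp
    hence "poly (char_poly A) (snd x) = 0"
      unfolding jordan_nf_char_poly[OF nf] poly_prod_list prod_list_zero_iff using x
      by (auto simp: image_iff split_beta intro!: bexI[of _ x])
    thus ?thesis by (simp add: cp)
  qed
  define lam where "lam = rev (sort (map fst nas))"
  have "map (\<lambda>k. (k, 0)) (map fst nas) = nas"
    using zero by (auto intro!: map_idI simp: prod_eq_iff)
  moreover have ms: "mset lam = mset (map fst nas)" by (simp add: lam_def)
  hence "mset (map (\<lambda>k. (k, 0 :: 'a)) lam) = mset (map (\<lambda>k. (k, 0)) (map fst nas))"
    unfolding mset_map[of "\<lambda>k. (k, 0)"] by (rule arg_cong)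
  ultimately have "mset (map (\<lambda>k. (k, 0)) lam) = mset nas" by simp
  hence perm: "similar_mat (jordan_matrix nas) (jordan_matrix (map (\<lambda>k. (k, 0)) lam))"
    by (intro similar_jordan_matrix_mset) simp
  have sim: "similar_mat A (jordan_matrix nas)" using nf by (simp add: jordan_nf_def)
  have set: "set lam = fst ` set nas" by (simp add: lam_def)
  have "0 \<notin> set lam" using pos by (force simp: set)
  hence "has_jordan_type A lam"
    using similar_mat_trans[OF sim perm] by (auto simp: has_jordan_type_def jordan_nf_def)
  moreover have "partition_of lam n" unfolding partition_of_def
  proof (intro conjI)
    show "sorted_wrt (\<ge>) lam" unfolding lam_def sorted_wrt_rev by simp
    show "\<forall>p\<in>set lam. 0 < p" using pos by (auto simp: set)
    have "sum_list lam = sum_list (map fst nas)"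
      using ms by (metis sum_mset_sum_list)
    also obtain m where "A \<in> carrier_mat m m" "jordan_matrix nas \<in> carrier_mat m m"
      using similar_matD[OF sim] by auto
    hence "sum_list (map fst nas) = n"
      using A jordan_matrix_dim(1)[of nas] by (metis carrier_matD(1))
    finally show "sum_list lam = n" .
  qed
  ultimately show ?thesis using that by blast
qed

lemma kernel_type_exists:
  fixes A :: "'a :: {field, finite} mat"
  assumes "A \<in> strict_upper_mats n"
  obtains E where "young E" "card E = n" "kernel_type A E"
proof -
  obtain lam where lam: "partition_of lam n" "has_jordan_type A lam"
    using jordan_type_exists[OF assms] .
  have "A \<in> carrier_mat n n" using assms by (simp add: strict_upper_mats_def)
  thus ?thesis
    using that[of "diagram lam"] lam young_diagram[OF lam(1)] kernel_type_diagram card_diagram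
    by (auto simp: partition_of_def)
qed

text \<open>For \<open>k\<close> beyond the last column the kernel of the \<open>k\<close>th power
  has as many elements as the whole space. That power then kills every unit vector, so each of its
  columns is zero.\<close>

lemma nilpotent_if_kernel_type:
  fixes A :: "'a :: {field, finite} mat"
  assumes A: "A \<in> carrier_mat n n" and D: "young D" "card D = n" and ty: "kernel_type A D"
  shows "nilpotent_mat A"
proof -
  obtain k where k: "left_part D k = D" by (rule left_part_eventually[OF D(1)])
  have P: "A ^\<^sub>m k \<in> carrier_mat n n" using A by simp
  have "card (mat_kernel (A ^\<^sub>m k)) = card (carrier_vec n :: 'a vec set)"
    using ty k D(2) by (simp add: kernel_type_def card_carrier_vec)
  hence ker: "mat_kernel (A ^\<^sub>m k) = carrier_vec n"
    by (intro card_subset_eq mat_kernel_carrier[OF P]) auto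
  have "A ^\<^sub>m k = 0\<^sub>m n n"
  proof (rule eq_matI)
    fix i j assume ij: "i < dim_row (0\<^sub>m n n :: 'a mat)" "j < dim_col (0\<^sub>m n n :: 'a mat)"
    have "unit_vec n j \<in> mat_kernel (A ^\<^sub>m k)" unfolding ker by simp
    hence "(A ^\<^sub>m k *\<^sub>v unit_vec n j) $ i = 0" using ij by (simp add: mat_kernel[OF P])
    moreover have dims: "dim_row (A ^\<^sub>m k) = n" "dim_col (A ^\<^sub>m k) = n"
      by (rule carrier_matD[OF P])+
    moreover have "row (A ^\<^sub>m k) i \<bullet> unit_vec n j = row (A ^\<^sub>m k) i $ j"
      using ij dims by (intro scalar_prod_right_unit) (auto simp: carrier_vec_def)
    ultimately show "(A ^\<^sub>m k) $$ (i, j) = 0\<^sub>m n n $$ (i, j)" using ij by simp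
  qed (use carrier_matD[OF P] in simp_all)
  thus ?thesis using A by (auto simp: nilpotent_mat_def)
qed

text \<open>A Jordan type with eigenvalue 0 forces a zero diagonal and the stated kernel sizes.
  Conversely, a strictly upper triangular matrix has some Jordan type, and the kernel sizes identify
  its diagram and hence its partition.\<close>

lemma triangular_nilpotents_eq:
  assumes lam: "partition_of lam n"
  shows "triangular_nilpotents TYPE('a :: {field, finite}) n lam =
    {A \<in> strict_upper_mats n. kernel_type A (diagram lam)}"
proof (intro equalityI subsetI)
  fix A :: "'a mat" assume "A \<in> triangular_nilpotents TYPE('a) n lam"
  hence A: "A \<in> carrier_mat n n" "upper_triangular A" "has_jordan_type A lam"
    by (auto simp: triangular_nilpotents_def)
  have "A $$ (i, j) = 0" if "i < n" "j \<le> i" for i j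
    using diag_eq_0_if_jordan_type[OF A that(1)] upper_triangularD[OF A(2), of j i] A(1) that
    by (cases "j = i") auto
  thus "A \<in> {A \<in> strict_upper_mats n. kernel_type A (diagram lam)}"
    using A(1) kernel_type_diagram[OF A(1,3)] by (simp add: strict_upper_mats_def)
next
  fix A :: "'a mat" assume "A \<in> {A \<in> strict_upper_mats n. kernel_type A (diagram lam)}"
  hence A: "A \<in> strict_upper_mats n" and ty: "kernel_type A (diagram lam)" by auto
  have carr: "A \<in> carrier_mat n n" and ut: "upper_triangular A"
    using A by (auto simp: strict_upper_mats_def)
  obtain mu where mu: "partition_of mu n" "has_jordan_type A mu" by (rule jordan_type_exists[OF A])
  have "diagram lam = diagram mu"
    using kernel_type_unique[OF young_diagram[OF lam] young_diagram[OF mu(1)] ty]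
      kernel_type_diagram[OF carr mu(2)] by blast
  hence "lam = mu" by (rule diagram_inj[OF lam mu(1)])
  moreover have "nilpotent_mat A"
    using nilpotent_if_kernel_type[OF carr young_diagram[OF lam] _ ty] lam
    by (simp add: card_diagram partition_of_def)
  ultimately show "A \<in> triangular_nilpotents TYPE('a) n lam"
    using carr ut mu by (simp add: triangular_nilpotents_def)
qed

subsection \<open>The recursion over corners\<close>

text \<open>The last row of a strictly upper triangular matrix is zero, so the leading block and the
  last column recover the matrix.\<close>

lemma bij_betw_border:
  "bij_betw (\<lambda>(B, v). border B v) (strict_upper_mats n \<times> carrier_vec n)
     (strict_upper_mats (Suc n) :: 'a :: zero mat set)"
proof (rule bij_betw_byWitness[where
      f' = "\<lambda>A. (mat n n (\<lambda>(i, j). A $$ (i, j)), vec n (\<lambda>i. A $$ (i, n)))"])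
  show "\<forall>p\<in>(strict_upper_mats n \<times> carrier_vec n :: ('a mat \<times> 'a vec) set).
      (\<lambda>A. (mat n n (\<lambda>(i, j). A $$ (i, j)), vec n (\<lambda>i. A $$ (i, n)))) ((\<lambda>(B, v). border B v) p) = p"
    by (auto simp: strict_upper_mats_def border_index intro!: eq_matI eq_vecI)
  show "\<forall>A\<in>(strict_upper_mats (Suc n) :: 'a mat set). (\<lambda>(B, v). border B v)
      (mat n n (\<lambda>(i, j). A $$ (i, j)), vec n (\<lambda>i. A $$ (i, n))) = A"
  proof
    fix A :: "'a mat" assume A: "A \<in> strict_upper_mats (Suc n)"
    let ?B = "mat n n (\<lambda>(i, j). A $$ (i, j))" and ?v = "vec n (\<lambda>i. A $$ (i, n))"
    have B: "?B \<in> carrier_mat n n" by simp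
    have "border ?B ?v = A"
    proof (rule eq_matI)
      fix i j assume "i < dim_row A" "j < dim_col A"
      hence ij: "i < Suc n" "j < Suc n" using A by (auto simp: strict_upper_mats_def)
      show "border ?B ?v $$ (i, j) = A $$ (i, j)"
        unfolding border_index[OF B ij] using ij A by (auto simp: strict_upper_mats_def less_Suc_eq)
    qed (use A carrier_matD[OF border_carrier[OF B, of ?v]] in \<open>auto simp: strict_upper_mats_def\<close>)
    thus "(\<lambda>(B, v). border B v) (?B, ?v) = A" by simp
  qed
  show "(\<lambda>(B, v). border B v) ` (strict_upper_mats n \<times> carrier_vec n) \<subseteq>
      (strict_upper_mats (Suc n) :: 'a mat set)"
    by (auto simp: strict_upper_mats_def border_carrier border_index)
  show "(\<lambda>A. (mat n n (\<lambda>(i, j). A $$ (i, j)), vec n (\<lambda>i. A $$ (i, n)))) ` (strict_upper_mats (Suc n) :: 'a mat set)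
      \<subseteq> strict_upper_mats n \<times> carrier_vec n"
    by (auto simp: strict_upper_mats_def)
qed

lemma card_mat_kernel_pow_0:
  fixes A :: "'a :: {field, finite} mat"
  assumes "A \<in> carrier_mat n n"
  shows "card (mat_kernel (A ^\<^sub>m 0)) = 1"
proof -
  have "mat_kernel (A ^\<^sub>m 0) = {0\<^sub>v n}" using assms by (auto simp: mat_kernel_def)
  thus ?thesis by simp
qed

text \<open>Comparing exponents of \<open>CARD('a)\<close> turns the factor from bordering into an
  added 1. The zeroth power imposes no condition, so only the powers \<open>Suc k\<close>
  remain.\<close>

lemma kernel_type_border_iff:
  fixes B :: "'a :: {field, finite} mat"
  assumes B: "B \<in> carrier_mat n n" and v: "v \<in> carrier_vec n" and E: "kernel_type B E"
    and D: "young D"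
  shows "kernel_type (border B v) D \<longleftrightarrow>
    (\<forall>k. card (left_part D (Suc k)) = card (left_part E (Suc k)) + (if v \<in> step_space B k then 1 else 0))"
proof -
  have "card (mat_kernel (border B v ^\<^sub>m 0)) = CARD('a) ^ card (left_part D 0)"
    using card_mat_kernel_pow_0[OF border_carrier[OF B]] by (simp add: left_part_0[OF D])
  hence "kernel_type (border B v) D \<longleftrightarrow>
      (\<forall>k. card (mat_kernel (border B v ^\<^sub>m Suc k)) = CARD('a) ^ card (left_part D (Suc k)))"
    unfolding kernel_type_def by (metis not0_implies_Suc)
  also have "\<dots> \<longleftrightarrow> (\<forall>k. CARD('a) ^ (card (left_part E (Suc k)) + (if v \<in> step_space B k then 1 else 0)) =
      CARD('a) ^ card (left_part D (Suc k)))"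
  proof -
    have "card (mat_kernel (border B v ^\<^sub>m Suc k)) =
        CARD('a) ^ (card (left_part E (Suc k)) + (if v \<in> step_space B k then 1 else 0))" for k
      unfolding card_kernel_pow_border[OF B v] E[unfolded kernel_type_def, rule_format, of "Suc k"]
      by (simp only: power_add power_one_right power_0 if_distrib[of "\<lambda>i. CARD('a) ^ i"])
    thus ?thesis by (simp only:)
  qed
  finally show ?thesis unfolding power_inject_exp[OF card_field_gt_1] by (simp only: eq_commute)
qed

lemma col_length_le_card:
  assumes "young D"
  shows "col_length D (Suc k) \<le> card D"
proof -
  have "card (left_part D (Suc k)) \<le> card D"
    using young_finite[OF assms] by (intro card_mono) (auto simp: left_part_def)
  thus ?thesis by (simp add: card_left_part_Suc[OF assms])
qed

text \<open>Kernel sizes of consecutive powers differ by a power whose exponent is a column length,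
  so cancelling in \<open>card_step_space\<close> leaves the stated exponent.\<close>

lemma card_step_space_young:
  fixes B :: "'a :: {field, finite} mat"
  assumes B: "B \<in> carrier_mat n n" and E: "young E" "card E = n" "kernel_type B E"
  shows "card (step_space B k) = CARD('a) ^ (n - col_length E (Suc k))"
proof -
  let ?q = "CARD('a)" and ?c = "col_length E (Suc k)" and ?l = "card (left_part E k)"
  have "card (step_space B k) * ?q ^ (?l + ?c) = ?q ^ n * ?q ^ ?l"
    using card_step_space[OF B, of k] E(3)
    by (simp only: kernel_type_def card_left_part_Suc[OF E(1)])
  hence "(card (step_space B k) * ?q ^ ?c) * ?q ^ ?l = ?q ^ n * ?q ^ ?l"
    by (simp add: power_add mult_ac)
  hence "card (step_space B k) * ?q ^ ?c = ?q ^ n" by simp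
  also have "\<dots> = ?q ^ (n - ?c) * ?q ^ ?c"
    using col_length_le_card[OF E(1), of k] E(2) by (simp flip: power_add)
  finally show ?thesis by simp
qed

lemma step_space_mono_le:
  assumes "B \<in> carrier_mat n n" "k \<le> l"
  shows "step_space B k \<subseteq> step_space B l"
  using step_space_mono[OF assms(1)] assms(2) by (rule lift_Suc_mono_le[of "step_space B"])

text \<open>If \<open>b\<close> is in column \<open>Suc j\<close>, the admissible \<open>v\<close>
  are those entering the increasing chain of step spaces exactly at index \<open>j\<close>. Removing
  \<open>b\<close> shortens only column \<open>Suc j\<close>; together with
  \<open>card D = Suc n\<close> this converts the exponents for \<open>D - {b}\<close> into those of
  \<open>box_weight D\<close>.\<close>

lemma card_border_kernel_type:
  fixes B :: "'a :: {field, finite} mat"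
  assumes B: "B \<in> carrier_mat n n" and D: "young D" "card D = Suc n" and b: "b \<in> corners D"
    and ty: "kernel_type B (D - {b})"
  shows "int (card {v \<in> carrier_vec n. kernel_type (border B v) D}) =
    box_weight D (snd b) (int CARD('a))"
proof -
  let ?E = "D - {b}" and ?q = "CARD('a)"
  have bD: "b \<in> D" and E: "young ?E" using b by (auto simp: corners_def)
  have cE: "card ?E = n" using D(2) bD young_finite[OF D(1)] by simp
  note col = col_length_minus[OF D(1), of "fst b" "snd b", unfolded prod.collapse, OF bD]
  have "1 \<le> snd b" using young_pos[OF D(1), of "fst b" "snd b"] bD by simp
  then obtain j where j: "snd b = Suc j" by (cases "snd b") auto
  have "kernel_type (border B v) D \<longleftrightarrow> (\<forall>k. v \<in> step_space B k \<longleftrightarrow> j \<le> k)" if "v \<in> carrier_vec n" for v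
    unfolding kernel_type_border_iff[OF B that ty D(1)] card_left_part_corner[OF D(1) bD] j by auto
  \<comment> \<open>Writing the exclusion with \<open>j = Suc i\<close> makes it vacuous for
    \<open>j = 0\<close>, the first-column case with no subtracted term.\<close>
  moreover have "(\<forall>k. v \<in> step_space B k \<longleftrightarrow> j \<le> k) \<longleftrightarrow>
      v \<in> step_space B j \<and> (\<forall>i. j = Suc i \<longrightarrow> v \<notin> step_space B i)" for v
  proof
    assume *: "v \<in> step_space B j \<and> (\<forall>i. j = Suc i \<longrightarrow> v \<notin> step_space B i)"
    show "\<forall>k. v \<in> step_space B k \<longleftrightarrow> j \<le> k"
    proof
      fix k
      show "v \<in> step_space B k \<longleftrightarrow> j \<le> k"
      proof (cases "j \<le> k")
        case True
        thus ?thesis using * step_space_mono_le[OF B True] by auto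
      next
        case False
        then obtain i where "j = Suc i" "k \<le> i" by (cases j) auto
        thus ?thesis using * step_space_mono_le[OF B, of k i] by auto
      qed
    qed
  qed auto
  moreover have "v \<in> carrier_vec n" if "v \<in> step_space B k" for v k
    using B that by (auto simp: step_space_def)
  ultimately have eq: "{v \<in> carrier_vec n. kernel_type (border B v) D} =
      {v \<in> step_space B j. \<forall>i. j = Suc i \<longrightarrow> v \<notin> step_space B i}"
    by blast
  note card_step = card_step_space_young[OF B E cE ty]
  show ?thesis
  proof (cases j)
    case 0
    have "num_rows D = Suc (col_length ?E 1)" using col[of 1] j 0 by (simp add: num_rows_young[OF D(1)])
    thus ?thesis unfolding eq using card_step[of 0] 0 j D(2) by (simp add: box_weight_def)
  next
    case (Suc i)
    have "{v \<in> step_space B j. \<forall>i. j = Suc i \<longrightarrow> v \<notin> step_space B i} = step_space B j - step_space B i"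
      using Suc by auto
    moreover have fin: "finite (step_space B j)"
      by (rule finite_subset[OF _ finite_carrier_vec[of n]]) (use B in \<open>auto simp: step_space_def\<close>)
    ultimately have "int (card {v \<in> carrier_vec n. kernel_type (border B v) D}) =
        int (card (step_space B j)) - int (card (step_space B i))"
      unfolding eq using step_space_mono[OF B, of i] Suc
      by (simp add: card_Diff_subset finite_subset card_mono of_nat_diff)
    moreover have "col_length D (Suc j) = Suc (col_length ?E (Suc j))" using col[of "Suc j"] j by simp
    moreover have "col_length D j = col_length ?E j" using col[of j] j by simp
    ultimately show ?thesis
      using card_step[of j] card_step[of i] Suc j D(2) by (simp add: box_weight_def)
  qed
qed

lemma finite_carrier_mat: "finite (carrier_mat n m :: 'a :: finite mat set)"
proof -
  let ?F = "({..<n} \<times> {..<m}) \<rightarrow>\<^sub>E (UNIV :: 'a set)"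
  have "A \<in> mat n m ` ?F" if "A \<in> carrier_mat n m" for A :: "'a mat"
  proof
    show "A = mat n m (restrict (\<lambda>p. A $$ p) ({..<n} \<times> {..<m}))" using that by (intro eq_matI) auto
  qed auto
  hence "carrier_mat n m \<subseteq> mat n m ` ?F" by blast
  moreover have "finite ?F" by (rule finite_PiE) simp_all
  ultimately show ?thesis by (metis finite_imageI finite_subset)
qed

lemma bij_betw_Collect_image:
  "bij_betw f A B \<Longrightarrow> bij_betw f {x \<in> A. P (f x)} {y \<in> B. P y}"
  by (auto simp: bij_betw_def inj_on_def)

text \<open>Bordered matrices of type \<open>D\<close> are sorted by the type of their leading
  block, which is always \<open>D\<close> with one corner removed; the number of last columns
  depends only on that corner.\<close>

lemma card_kernel_type_Suc:
  assumes D: "young D" "card D = Suc n"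
  shows "int (card {A \<in> strict_upper_mats (Suc n). kernel_type (A :: 'a :: {field, finite} mat) D}) =
    (\<Sum>b\<in>corners D. int (card {B \<in> strict_upper_mats n. kernel_type (B :: 'a mat) (D - {b})}) *
       box_weight D (snd b) (int CARD('a)))"
proof -
  define S where "S = (\<lambda>b. SIGMA B:{B \<in> strict_upper_mats n. kernel_type (B :: 'a mat) (D - {b})}.
    {v \<in> carrier_vec n. kernel_type (border B v) D})"
  let ?P = "{p \<in> strict_upper_mats n \<times> carrier_vec n. kernel_type (case p of (B, v) \<Rightarrow> border B v) D}
    :: ('a mat \<times> 'a vec) set"
  have fin: "finite (strict_upper_mats n :: 'a mat set)"
    by (rule finite_subset[OF _ finite_carrier_mat[of n n]]) (auto simp: strict_upper_mats_def)
  have "bij_betw (\<lambda>(B, v). border B v) ?P {A \<in> strict_upper_mats (Suc n). kernel_type A D}"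
    by (rule bij_betw_Collect_image[OF bij_betw_border])
  hence "card {A \<in> strict_upper_mats (Suc n). kernel_type (A :: 'a mat) D} = card ?P"
    by (simp add: bij_betw_same_card)
  also have "?P = (\<Union>b\<in>corners D. S b)"
  proof (intro equalityI subsetI)
    fix p assume "p \<in> ?P"
    then obtain B v where p: "p = (B, v)" and B: "B \<in> strict_upper_mats n" and v: "v \<in> carrier_vec n"
      and ty: "kernel_type (border B v) D" by auto
    have carr: "B \<in> carrier_mat n n" using B by (simp add: strict_upper_mats_def)
    obtain E where E: "young E" "card E = n" "kernel_type B E" by (rule kernel_type_exists[OF B])
    have step: "card (left_part D (Suc k)) = card (left_part E (Suc k)) + (if v \<in> step_space B k then 1 else 0)" for k
      using ty kernel_type_border_iff[OF carr v E(3) D(1)] by blast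
    \<comment> \<open>Otherwise bordering would change no kernel size, giving \<open>D = E\<close>
      although \<open>D\<close> has one more box.\<close>
    have "\<exists>k. v \<in> step_space B k"
    proof (rule ccontr)
      assume no: "\<nexists>k. v \<in> step_space B k"
      have "card (left_part D k) = card (left_part E k)" for k
        using step[of "k - 1"] no left_part_0[OF D(1)] left_part_0[OF E(1)] by (cases k) auto
      hence "D = E" by (rule young_eq_left_part[OF D(1) E(1)])
      thus False using D(2) E(2) by simp
    qed
    define j where "j = (LEAST k. v \<in> step_space B k)"
    have mem: "v \<in> step_space B k \<longleftrightarrow> j \<le> k" for k
    proof
      show "v \<in> step_space B k \<Longrightarrow> j \<le> k" unfolding j_def by (rule Least_le)
      have "v \<in> step_space B j" unfolding j_def using \<open>\<exists>k. v \<in> step_space B k\<close> by (rule LeastI_ex)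
      thus "j \<le> k \<Longrightarrow> v \<in> step_space B k" using step_space_mono_le[OF carr] by blast
    qed
    \<comment> \<open>\<open>step_space B k\<close> governs the power \<open>Suc k\<close>, so entry
      at index \<open>j\<close> adds a box in column \<open>Suc j\<close>.\<close>
    have "card (left_part D k) = card (left_part E k) + (if Suc j \<le> k then 1 else 0)" for k
      using step[of "k - 1"] left_part_0[OF D(1)] left_part_0[OF E(1)] by (cases k) (auto simp: mem)
    then obtain b where "b \<in> corners D" "D - {b} = E" using remove_box_eq[OF D(1) E(1)] by metis
    thus "p \<in> (\<Union>b\<in>corners D. S b)" using p B v ty E(3) by (auto simp: S_def)
  next
    fix p assume "p \<in> (\<Union>b\<in>corners D. S b)"
    thus "p \<in> ?P" by (auto simp: S_def)
  qed
  also have "card (\<Union>b\<in>corners D. S b) = (\<Sum>b\<in>corners D. card (S b))"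
  proof (rule card_UN_disjoint)
    show "finite (corners D)" using young_finite[OF D(1)] by (simp add: corners_def)
    show "\<forall>b\<in>corners D. finite (S b)"
      using fin by (auto simp: S_def intro!: finite_SigmaI)
    \<comment> \<open>Different corners leave different diagrams, and one leading block cannot have
      two kernel types.\<close>
    show "\<forall>b\<in>corners D. \<forall>c\<in>corners D. b \<noteq> c \<longrightarrow> S b \<inter> S c = {}"
    proof (intro ballI impI)
      fix b c assume bc: "b \<in> corners D" "c \<in> corners D" "b \<noteq> c"
      have "D - {b} \<noteq> D - {c}" using bc by (auto simp: corners_def)
      hence "\<not> (kernel_type B (D - {b}) \<and> kernel_type B (D - {c}))" for B :: "'a mat"
        using kernel_type_unique[of "D - {b}" "D - {c}" B] bc by (auto simp: corners_def)
      thus "S b \<inter> S c = {}" by (auto simp: S_def)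
    qed
  qed
  also have "int \<dots> = (\<Sum>b\<in>corners D. int (card {B \<in> strict_upper_mats n. kernel_type (B :: 'a mat) (D - {b})}) *
      box_weight D (snd b) (int CARD('a)))"
    unfolding of_nat_sum
  proof (rule sum.cong[OF refl])
    fix b assume b: "b \<in> corners D"
    have "card (S b) = (\<Sum>B\<in>{B \<in> strict_upper_mats n. kernel_type (B :: 'a mat) (D - {b})}.
        card {v \<in> carrier_vec n. kernel_type (border B v) D})"
      unfolding S_def using fin by (intro card_SigmaI) auto
    hence "int (card (S b)) = (\<Sum>B\<in>{B \<in> strict_upper_mats n. kernel_type (B :: 'a mat) (D - {b})}.
        int (card {v \<in> carrier_vec n. kernel_type (border B v) D}))"
      by (simp only: of_nat_sum)
    also have "\<dots> = (\<Sum>B\<in>{B \<in> strict_upper_mats n. kernel_type (B :: 'a mat) (D - {b})}.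
        box_weight D (snd b) (int CARD('a)))"
      by (intro sum.cong refl card_border_kernel_type[OF _ D b]) (auto simp: strict_upper_mats_def)
    finally show "int (card (S b)) = int (card {B \<in> strict_upper_mats n. kernel_type (B :: 'a mat) (D - {b})}) *
        box_weight D (snd b) (int CARD('a))" by simp
  qed
  finally show ?thesis .
qed

text \<open>Matrices and tableaux obey the same recursion over corners, so the counts agree by
  induction on the number of boxes.\<close>

lemma card_kernel_type:
  assumes "young D" "card D = n"
  shows "int (card {A \<in> strict_upper_mats n. kernel_type (A :: 'a :: {field, finite} mat) D}) =
    (\<Sum>T\<in>tableaux D. filling_weight D T (int CARD('a)))"
  using assms
proof (induction n arbitrary: D)
  case 0
  hence D: "D = {}" using young_finite by auto
  have "kernel_type (A :: 'a mat) {}" if A: "A \<in> carrier_mat 0 0" for A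
  proof -
    have "mat_kernel (A ^\<^sub>m k) = {0\<^sub>v 0}" for k
      using A by (auto simp: mat_kernel[of _ 0 0] intro!: eq_vecI)
    thus ?thesis by (simp add: kernel_type_def left_part_def)
  qed
  moreover have "strict_upper_mats 0 = {0\<^sub>m 0 0 :: 'a mat}"
    by (auto simp: strict_upper_mats_def intro!: eq_matI)
  ultimately have "{A \<in> strict_upper_mats 0. kernel_type (A :: 'a mat) D} = {0\<^sub>m 0 0}"
    using D by auto
  \<comment> \<open>The empty diagram has one filling, undefined everywhere, with the empty product
    1 as weight; it matches the single 0 by 0 matrix.\<close>
  moreover have "tableaux {} = {\<lambda>_. undefined}"
    by (auto simp: tableaux_def bij_betw_def)
  ultimately show ?case by (simp add: D filling_weight_def)
next
  case (Suc n)
  have "D \<noteq> {}" using Suc.prems(2) by auto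
  have IH: "int (card {B \<in> strict_upper_mats n. kernel_type (B :: 'a mat) (D - {b})}) =
      (\<Sum>T\<in>tableaux (D - {b}). filling_weight (D - {b}) T (int CARD('a)))" if "b \<in> corners D" for b
  proof (rule Suc.IH)
    show "young (D - {b})" using that by (simp add: corners_def)
    show "card (D - {b}) = n"
      using that Suc.prems young_finite[OF Suc.prems(1)] by (simp add: corners_def)
  qed
  show ?case
    unfolding card_kernel_type_Suc[OF Suc.prems] sum_tableaux_corners[OF Suc.prems(1) \<open>D \<noteq> {}\<close>]
    by (rule sum.cong[OF refl]) (simp only: IH)
qed

section \<open>Return to standard tableaux of a partition\<close>

lemma SYT_eq_tableaux: "SYT lam = tableaux (diagram lam)"
  by (simp only: SYT_def tableaux_def card_diagram)

text \<open>The two weights differ only in writing \<open>i\<close> or the number of boxes of the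
  subshape in the exponents. These agree because the subshape is in bijection with the entries from
  1 to \<open>i\<close>.\<close>

lemma tableau_poly_eq_filling_weight:
  assumes T: "T \<in> SYT lam"
  shows "tableau_poly lam T q = filling_weight (diagram lam) T q"
  unfolding tableau_poly_def filling_weight_def card_diagram
proof (rule prod.cong[OF refl])
  fix i assume i: "i \<in> {1..sum_list lam}"
  have bij: "bij_betw T (diagram lam) {1..sum_list lam}" using T by (simp add: SYT_def)
  have "T ` subshape lam T i = {1..i}"
  proof (intro equalityI subsetI)
    fix k assume k: "k \<in> {1..i}"
    hence "k \<in> T ` diagram lam" using bij i by (simp add: bij_betw_def)
    thus "k \<in> T ` subshape lam T i" using k by (auto simp: subshape_def)
  qed (auto simp: subshape_def)
  moreover have "inj_on T (subshape lam T i)"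
    using bij by (auto simp: bij_betw_def subshape_def intro: inj_on_subset)
  ultimately have "card (subshape lam T i) = i" by (metis card_atLeastAtMost card_image diff_Suc_1)
  thus "tableau_factor lam T i q =
      box_weight {b \<in> diagram lam. 1 \<le> T b \<and> T b \<le> i} (snd (inv_into (diagram lam) T i)) q"
    by (simp add: tableau_factor_def box_weight_def Let_def entry_col_def subshape_def)
qed

theorem mainTheorem1:
  fixes n q :: nat and lam :: "nat list"
  assumes "n \<ge> 1"
    and "partition_of lam n"
    and "card (UNIV :: 'a :: {field, finite} set) = q"
  shows "int (card (triangular_nilpotents TYPE('a) n lam)) =
         (\<Sum>T \<in> SYT lam. tableau_poly lam T (int q))"
proof -
  have "card (diagram lam) = n" using assms(2) by (simp add: card_diagram partition_of_def)
  hence "int (card (triangular_nilpotents TYPE('a) n lam)) =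
      (\<Sum>T\<in>tableaux (diagram lam). filling_weight (diagram lam) T (int q))"
    unfolding triangular_nilpotents_eq[OF assms(2)] assms(3)[symmetric]
    by (rule card_kernel_type[OF young_diagram[OF assms(2)]])
  also have "\<dots> = (\<Sum>T\<in>SYT lam. tableau_poly lam T (int q))"
    unfolding SYT_eq_tableaux[symmetric] by (rule sum.cong[OF refl]) (simp only: tableau_poly_eq_filling_weight)
  finally show ?thesis .
qed

end
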